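(* Let $n\ge 2$, $v\in\tilde{S}_n$, $r\in\mathbb{Z}$, and let $\alpha=(\alpha_1,\dots,\alpha_m)$ be a composition of $\ell(v)+1$. The generalized affine Little algorithm (described in the context) is well defined and gives a bijection from the set of $\alpha$-decompositions of elements of $\Psi^+_r(v)$ to the set of $\alpha$-decompositions of elements of $\Psi^-_r(v)$.
   Context: $\tilde{S}_n$ is the affine symmetric group (bijections $w:\mathbb{Z}\to\mathbb{Z}$ with $w(i+n)=w(i)+n$, $\sum_{i=1}^n w(i)=\sum_{i=1}^n i$), a Coxeter group with simple reflections $s_i$, $i\in\mathbb{Z}/n\mathbb{Z}$. For $r\not\equiv s\pmod n$, $t_{r,s}$ swaps $r$ and $s$ and fixes every integer not congruent to $r$ or $s$ mod $n$. $\ell$ is length; $v\lessdot w$ means $w=vt_{p,q}$ for some $p,q$ and $\ell(w)=\ell(v)+1$. $\Psi^+_r(v)=\{w: v\lessdot w,\ w=vt_{r,s},\ s>r\}$ and $\Psi^-_r(v)=\{w: v\lessdot w,\ w=vt_{s,r},\ s<r\}$. A proper subset $I\subsetneq\mathbb{Z}/n\mathbb{Z}$ of the form $\{i,i+1,\dots,i+j\}$ is a cyclic interval with word $(i+j)\cdots(i+1)i$. For a proper subset $A\subsetneq\mathbb{Z}/n\mathbb{Z}$, $w(A)\in\tilde{S}_n$ is the element with reduced word any shuffle of the words of the maximal cyclic subintervals of $A$; the cyclically decreasing elements of $\tilde{S}_n$ are exactly the $w(A)$, and $\ell(w(A))=|A|$, $w(A)\le w(B)$ in Bruhat order iff $A\subseteq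 B$. An $\alpha$-decomposition of $w$ with $\ell(w)=\sum\alpha_k$ is a tuple $(w^1,\dots,w^m)$ of cyclically decreasing elements with $\ell(w^k)=\alpha_k$ and $w=w^1\cdots w^m$. For $A$ a proper subset and $i\in A$, define $A'=\mathrm{L}(A,i)$ as follows: let $j\ge0$ be maximal with $\{i,i-1,\dots,i-j\}\subseteq A$ (mod $n$), and let $A'$ be obtained from $A$ by replacing $i$ with $i-j-1$; the induced map sends the cover $w(A)$ of $w(A\setminus\{i\})$ to the cover $w(A')$ of $w(A\setminus\{i\})$, and $i-j-1$ is the element of $A'$ whose removal gives $A\setminus\{i\}$. Algorithm: given an $\alpha$-decomposition $(y^1,\dots,y^m)$, $y^k=w(A_k)$, of $w\in\Psi^+_r(v)$, there is a unique factor index $i$ and element $a\in A_i$ with $v=y^1\cdots w(A_i\setminus\{a\})\cdots y^m$. (1) Replace $A_i$ by $\mathrm{L}(A_i,a)$ (so $y^i$ becomes $w(\mathrm{L}(A_i,a))$, marked at the new element $a^*$ with $A_i\setminus\{a\}=\mathrm{L}(A_i,a)\setminus\{a^*\}$). (2) If the new tuple is an $\alpha$-decomposition of its product (i.e. the product has length $\ell(v)+1$), output it. Otherwise there is a unique factor index $j\ne i$ and element $b\in A_j$ with $v$ equal to the product of the new tuple with $y^j$ replaced by $w(A_j\setminus\{b\})$; set $i:=j$, $a:=b$ and return to (1). *)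

theory Defs
  imports Main
begin

definition affperm :: "nat \<Rightarrow> (int \<Rightarrow> int) \<Rightarrow> bool" where
  "affperm n w \<longleftrightarrow> bij w \<and> (\<forall>i. w (i + int n) = w i + int n)
     \<and> (\<Sum>i\<in>{1..int n}. w i) = (\<Sum>i\<in>{1..int n}. i)"

definition tr :: "nat \<Rightarrow> int \<Rightarrow> int \<Rightarrow> int \<Rightarrow> int" where
  "tr n r s x = (if x mod int n = r mod int n then x - r + s
                 else if x mod int n = s mod int n then x - s + r else x)"

text \<open>Simple reflection s_i, i in Z/nZ represented by 0..n-1.\<close>
definition sref :: "nat \<Rightarrow> int \<Rightarrow> int \<Rightarrow> int" where
  "sref n i = tr n i (i + 1)"

definition word :: "nat \<Rightarrow> int list \<Rightarrow> int \<Rightarrow> int" where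
  "word n ws = foldr (\<lambda>i f. sref n i \<circ> f) ws id"

definition len :: "nat \<Rightarrow> (int \<Rightarrow> int) \<Rightarrow> nat" where
  "len n w = (LEAST k. \<exists>ws. length ws = k \<and> set ws \<subseteq> {0..<int n} \<and> w = word n ws)"

definition prodl :: "(int \<Rightarrow> int) list \<Rightarrow> int \<Rightarrow> int" where
  "prodl ys = foldr (\<circ>) ys id"

definition covers :: "nat \<Rightarrow> (int \<Rightarrow> int) \<Rightarrow> (int \<Rightarrow> int) \<Rightarrow> bool" where
  "covers n v w \<longleftrightarrow> (\<exists>p q. p mod int n \<noteq> q mod int n \<and> w = v \<circ> tr n p q)
      \<and> len n w = len n v + 1"

definition Psi_plus :: "nat \<Rightarrow> int \<Rightarrow> (int \<Rightarrow> int) \<Rightarrow> (int \<Rightarrow> int) set" where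
  "Psi_plus n r v = {w. covers n v w \<and>
      (\<exists>s. s > r \<and> s mod int n \<noteq> r mod int n \<and> w = v \<circ> tr n r s)}"

definition Psi_minus :: "nat \<Rightarrow> int \<Rightarrow> (int \<Rightarrow> int) \<Rightarrow> (int \<Rightarrow> int) set" where
  "Psi_minus n r v = {w. covers n v w \<and>
      (\<exists>s. s < r \<and> s mod int n \<noteq> r mod int n \<and> w = v \<circ> tr n s r)}"

text \<open>Proper subsets of Z/nZ, with Z/nZ represented by {0..<n}.\<close>
definition proper :: "nat \<Rightarrow> int set \<Rightarrow> bool" where
  "proper n A \<longleftrightarrow> A \<subset> {0..<int n}"

text \<open>A word is a shuffle of the decreasing words (i+j)...(i+1)i of the maximal cyclic
  subintervals of A: it uses each letter of A exactly once, and whenever j and j+1 (mod n)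
  both lie in A, the letter j+1 occurs before j.\<close>
definition cd_word :: "nat \<Rightarrow> int set \<Rightarrow> int list \<Rightarrow> bool" where
  "cd_word n A ws \<longleftrightarrow> distinct ws \<and> set ws = A \<and>
     (\<forall>j\<in>A. (j + 1) mod int n \<in> A \<longrightarrow>
        (\<exists>p q. p < q \<and> q < length ws \<and> ws ! p = (j + 1) mod int n \<and> ws ! q = j))"

definition wA :: "nat \<Rightarrow> int set \<Rightarrow> int \<Rightarrow> int" where
  "wA n A = word n (SOME ws. cd_word n A ws)"

definition cyc_dec :: "nat \<Rightarrow> (int \<Rightarrow> int) \<Rightarrow> bool" where
  "cyc_dec n y \<longleftrightarrow> (\<exists>A. proper n A \<and> y = wA n A)"

definition cdset :: "nat \<Rightarrow> (int \<Rightarrow> int) \<Rightarrow> int set" where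
  "cdset n y = (THE A. proper n A \<and> y = wA n A)"

definition is_decomp :: "nat \<Rightarrow> nat list \<Rightarrow> (int \<Rightarrow> int) \<Rightarrow> (int \<Rightarrow> int) list \<Rightarrow> bool" where
  "is_decomp n \<alpha> w ys \<longleftrightarrow> len n w = sum_list \<alpha> \<and> length ys = length \<alpha> \<and>
     (\<forall>k<length ys. cyc_dec n (ys ! k) \<and> len n (ys ! k) = \<alpha> ! k) \<and> w = prodl ys"

definition Ljmax :: "nat \<Rightarrow> int set \<Rightarrow> int \<Rightarrow> nat" where
  "Ljmax n A i = (GREATEST j. j < n \<and> (\<forall>k\<le>j. (i - int k) mod int n \<in> A))"

definition Lnew :: "nat \<Rightarrow> int set \<Rightarrow> int \<Rightarrow> int" where
  "Lnew n A i = (i - int (Ljmax n A i) - 1) mod int n"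

definition Lmap :: "nat \<Rightarrow> int set \<Rightarrow> int \<Rightarrow> int set" where
  "Lmap n A i = insert (Lnew n A i) (A - {i})"

definition removal_pos :: "nat \<Rightarrow> (int \<Rightarrow> int) \<Rightarrow> (int \<Rightarrow> int) list \<Rightarrow> nat \<Rightarrow> int \<Rightarrow> bool" where
  "removal_pos n v ys i a \<longleftrightarrow> i < length ys \<and> a \<in> cdset n (ys ! i) \<and>
     v = prodl (ys[i := wA n (cdset n (ys ! i) - {a})])"

definition step_tuple :: "nat \<Rightarrow> (int \<Rightarrow> int) list \<Rightarrow> nat \<Rightarrow> int \<Rightarrow> (int \<Rightarrow> int) list" where
  "step_tuple n ys i a = ys[i := wA n (Lmap n (cdset n (ys ! i)) a)]"

text \<open>little_from n \<alpha> v ys i a zs: running the algorithm from the tuple ys with current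
  marked position (i,a) terminates (after finitely many loops, with all uniqueness
  requirements met at every loop) and outputs zs.\<close>
inductive little_from :: "nat \<Rightarrow> nat list \<Rightarrow> (int \<Rightarrow> int) \<Rightarrow> (int \<Rightarrow> int) list \<Rightarrow> nat \<Rightarrow> int
    \<Rightarrow> (int \<Rightarrow> int) list \<Rightarrow> bool" for n \<alpha> v where
  stop_out: "is_decomp n \<alpha> (prodl (step_tuple n ys i a)) (step_tuple n ys i a) \<Longrightarrow>
     little_from n \<alpha> v ys i a (step_tuple n ys i a)"
| loop_on: "\<not> is_decomp n \<alpha> (prodl (step_tuple n ys i a)) (step_tuple n ys i a) \<Longrightarrow>
     (\<exists>!(j, b). j \<noteq> i \<and> removal_pos n v (step_tuple n ys i a) j b) \<Longrightarrow>
     j \<noteq> i \<Longrightarrow> removal_pos n v (step_tuple n ys i a) j b \<Longrightarrow>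
     little_from n \<alpha> v (step_tuple n ys i a) j b zs \<Longrightarrow>
     little_from n \<alpha> v ys i a zs"

definition little_alg :: "nat \<Rightarrow> nat list \<Rightarrow> (int \<Rightarrow> int) \<Rightarrow> (int \<Rightarrow> int) list
    \<Rightarrow> (int \<Rightarrow> int) list \<Rightarrow> bool" where
  "little_alg n \<alpha> v ys zs \<longleftrightarrow> (\<exists>!(i, a). removal_pos n v ys i a) \<and>
     (\<exists>i a. removal_pos n v ys i a \<and> little_from n \<alpha> v ys i a zs)"

end

theory Submission
  imports Defs
begin

text \<open>A marked letter in a product of cyclically decreasing elements is a crossing of two wires,
  and deleting it multiplies the product by the corresponding reflection. If deletion gives
  \<open>v\<close>, the marked crossing involves the wire \<open>r\<close> either as the lower or as
  the upper wire. Inside a factor, \<open>L\<close> cyclically permutes the letters outside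
  \<open>A - {a}\<close>, and the upper wire of the new letter is the lower wire of the old one; so
  \<open>L\<close> is a bijection from the marked tuples with \<open>r\<close> low to those with
  \<open>r\<close> high. If a tuple is not reduced, its two wires cross exactly twice, and passing to the
  other crossing exchanges low and high. The algorithm alternates these two injections on a finite
  set, starting outside the range of the second, so it must stop, and counting shows that it is a
  bijection between the reduced low and the reduced high marked tuples. These are the
  \<open>\<alpha>\<close>-decompositions over \<open>\<Psi>\<^sup>+\<close> and
  \<open>\<Psi>\<^sup>-\<close>.\<close>

text \<open>The number of crossings is controlled by the deletion itself. It leaves
  \<open>len n v\<close> letters with product \<open>v\<close>, that is, a reduced tuple, and in a
  reduced tuple a pair of wires crosses at most once: two crossings could both be deleted without
  changing the product. So outside the marked factor the pair crosses at most once. If it crosses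
  nowhere else, its order at the exit is opposite to that at the entry, the product is then longer
  than \<open>v\<close>, and the tuple is reduced. Otherwise the second crossing undoes the first,
  which is why passing to it exchanges low and high. Inversions are never counted. Every statement
  on length comes from deleting a letter at the cost of a reflection. The delicate point is
  periodicity: wires are integers up to a common shift by \<open>n\<close>, and a run of letters of
  a proper set must be kept from wrapping around.\<close>

locale affine =
  fixes n :: nat
  assumes n2: "2 \<le> n"
begin

abbreviation N :: int where "N \<equiv> int n"

section \<open>Periodic bijections of the integers and affine reflections\<close>

lemma mod_eq_shift: "x mod N = y mod N \<Longrightarrow> \<exists>k. x = y + k * N"
  unfolding mod_eq_dvd_iff by (auto simp: dvd_def algebra_simps)

text \<open>These maps form the extended affine symmetric group.\<close>

definition equivariant :: "(int \<Rightarrow> int) \<Rightarrow> bool" where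
  "equivariant g \<longleftrightarrow> bij g \<and> (\<forall>x. g (x + N) = g x + N)"

lemma equivariant_shift:
  assumes "equivariant g" shows "g (x + k * N) = g x + k * N"
proof -
  have s: "g (x + N) = g x + N" for x using assms by (simp add: equivariant_def)
  have pos: "g (x + int m * N) = g x + int m * N" for x m
  proof (induction m)
    case (Suc m)
    then show ?case using s[of "x + int m * N"] by (simp add: algebra_simps)
  qed simp
  show ?thesis
  proof (cases "k \<ge> 0")
    case True
    then show ?thesis using pos[of x "nat k"] by simp
  next
    case False
    then show ?thesis using pos[of "x + k * N" "nat (- k)"] by (simp add: algebra_simps)
  qed
qed

lemma equivariant_mod_iff:
  assumes "equivariant g" shows "g x mod N = g y mod N \<longleftrightarrow> x mod N = y mod N"
proof
  assume "g x mod N = g y mod N"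
  then obtain k where "g x = g y + k * N" using mod_eq_shift by blast
  then have "g x = g (y + k * N)" by (simp add: equivariant_shift[OF assms])
  then have "x = y + k * N" using assms by (auto simp: equivariant_def bij_def dest: injD)
  then show "x mod N = y mod N" by simp
next
  assume "x mod N = y mod N"
  then obtain k where "x = y + k * N" using mod_eq_shift by blast
  then show "g x mod N = g y mod N" by (simp add: equivariant_shift[OF assms])
qed

lemma equivariant_eq_iff: "equivariant g \<Longrightarrow> g x = g y \<longleftrightarrow> x = y"
  by (auto simp: equivariant_def bij_def dest: injD)

lemma equivariant_id: "equivariant id"
  by (simp add: equivariant_def)

lemma equivariant_comp: "equivariant f \<Longrightarrow> equivariant g \<Longrightarrow> equivariant (f \<circ> g)"
  by (simp add: equivariant_def bij_comp)

lemma tr_commute: "p mod N \<noteq> q mod N \<Longrightarrow> tr n p q = tr n q p"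
  by (auto simp: tr_def)

lemma tr_left [simp]: "tr n p q (p + k * N) = q + k * N"
  by (simp add: tr_def)

lemma tr_right [simp]: "p mod N \<noteq> q mod N \<Longrightarrow> tr n p q (q + k * N) = p + k * N"
  by (simp add: tr_def)

lemma tr_left0 [simp]: "tr n p q p = q"
  by (simp add: tr_def)

lemma tr_right0 [simp]: "p mod N \<noteq> q mod N \<Longrightarrow> tr n p q q = p"
  by (simp add: tr_def)

lemma tr_other: "x mod N \<noteq> p mod N \<Longrightarrow> x mod N \<noteq> q mod N \<Longrightarrow> tr n p q x = x"
  by (simp add: tr_def)

lemma tr_cases:
  obtains (left) k where "x = p + k * N" | (right) k where "x = q + k * N" |
    (other) "x mod N \<noteq> p mod N" "x mod N \<noteq> q mod N"
  using mod_eq_shift by blast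

lemma tr_involution: "p mod N \<noteq> q mod N \<Longrightarrow> tr n p q (tr n p q x) = x"
  by (cases rule: tr_cases[where x = x and p = p and q = q]) (simp_all add: tr_other)

lemma tr_involution_comp [simp]: "p mod N \<noteq> q mod N \<Longrightarrow> f \<circ> tr n p q \<circ> tr n p q = f"
  by (rule ext) (simp add: tr_involution)

lemma equivariant_tr:
  assumes "p mod N \<noteq> q mod N" shows "equivariant (tr n p q)"
proof -
  have "bij (tr n p q)"
    by (rule o_bij[of "tr n p q"]) (auto simp: fun_eq_iff tr_involution[OF assms])
  moreover have "tr n p q (x + N) = tr n p q x + N" for x
    by (simp add: tr_def)
  ultimately show ?thesis by (simp add: equivariant_def)
qed

text \<open>Conjugation carries a reflection to the reflection in the image positions. This is how a
  deletion inside a factor becomes right multiplication of the whole product.\<close>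

lemma tr_conj:
  assumes g: "equivariant g" and pq: "p mod N \<noteq> q mod N"
  shows "g (tr n p q x) = tr n (g p) (g q) (g x)"
proof -
  have *: "g p mod N \<noteq> g q mod N" using equivariant_mod_iff[OF g] pq by simp
  show ?thesis
  proof (cases rule: tr_cases[where x = x and p = p and q = q])
    case (other)
    then show ?thesis using equivariant_mod_iff[OF g] by (simp add: tr_other)
  qed (use * pq in \<open>simp_all add: equivariant_shift[OF g]\<close>)
qed

lemma tr_conj_comp:
  assumes "equivariant g" and "p mod N \<noteq> q mod N"
  shows "g \<circ> tr n p q = tr n (g p) (g q) \<circ> g"
  using tr_conj[OF assms] by auto

text \<open>A reflection determines its pair of positions up to exchange and a common shift, as seen
  by evaluating both sides at \<open>p\<close>.\<close>

lemma tr_eqD: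
  assumes pq: "p mod N \<noteq> q mod N" and e: "tr n p q = tr n p' q'"
  shows "\<exists>k. p = p' + k * N \<and> q = q' + k * N \<or> p = q' + k * N \<and> q = p' + k * N"
proof -
  have q: "q = tr n p' q' p" using e by (metis tr_left0)
  have ne: "p \<noteq> q" using pq by auto
  show ?thesis
  proof (cases rule: tr_cases[where x = p and p = p' and q = q'])
    case (right k)
    then show ?thesis
    \<comment> \<open>If \<open>p'\<close> and \<open>q'\<close> are congruent, the first branch of
      \<open>tr\<close> acts on the class and merely translates it, so \<open>q\<close> arises from
      \<open>q'\<close> by the same shift as \<open>p\<close> from \<open>p'\<close>.\<close>
    proof (cases "p' mod N = q' mod N")
      case True
      then obtain l where "q' = p' + l * N" using mod_eq_shift by metis
      then have "p = p' + (l + k) * N" using right by (simp add: algebra_simps)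
      then show ?thesis using q tr_left by metis
    qed (use q in auto)
  qed (use q ne in \<open>auto simp: tr_other\<close>)
qed

lemma tr_shift: "tr n (p + k * N) (q + k * N) = tr n p q"
  by (rule ext) (simp add: tr_def)

lemma sref_consecutive: "i mod N \<noteq> (i + 1) mod N"
proof
  assume "i mod N = (i + 1) mod N"
  then have "N dvd 1" by (metis add_diff_cancel_left' mod_eq_dvd_iff)
  then show False using n2 by simp
qed

section \<open>Cyclically decreasing elements as explicit permutations\<close>

text \<open>The closed form of w(A). Within a run the smaller letters act first, so a wire with a
  letter just below it drops by exactly one, while any other wire is pushed up through consecutive
  letters to the first gap.\<close>

definition cdf :: "int set \<Rightarrow> int \<Rightarrow> int" where
  "cdf A x = (if (x - 1) mod N \<in> A then x - 1
     else x + int (LEAST j. (x + int j) mod N \<notin> A))"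

lemma proper_gap:
  assumes "proper n A" obtains z where "x \<le> z" "z mod N \<notin> A"
proof -
  obtain y where y: "y \<in> {0..<N}" "y \<notin> A" using assms unfolding proper_def by blast
  have "(x + (y - x) mod N) mod N = y" using y by (simp add: mod_simps)
  moreover have "x \<le> x + (y - x) mod N" using n2 by simp
  ultimately show ?thesis using y that by metis
qed

lemma next_gap:
  assumes "proper n A"
  obtains y where "x \<le> y" "y mod N \<notin> A" "\<And>z. x \<le> z \<Longrightarrow> z < y \<Longrightarrow> z mod N \<in> A"
proof -
  define P where "P j \<longleftrightarrow> (x + int j) mod N \<notin> A" for j
  define m where "m = (LEAST j. P j)"
  obtain z where "x \<le> z" "z mod N \<notin> A" using proper_gap[OF assms] .
  then have "P (nat (z - x))" by (simp add: P_def)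
  then have 1: "P m" unfolding m_def by (rule LeastI)
  have 2: "z mod N \<in> A" if "x \<le> z" "z < x + int m" for z
  proof -
    have "nat (z - x) < m" using that by linarith
    then have "\<not> P (nat (z - x))" unfolding m_def by (rule not_less_Least)
    then show ?thesis using that(1) by (simp add: P_def)
  qed
  show ?thesis
    by (rule that[of "x + int m"]) (use 1 2 in \<open>simp_all add: P_def\<close>)
qed

lemma prev_gap:
  assumes "proper n A"
  obtains y where "y \<le> x" "y mod N \<notin> A" "\<And>z. y < z \<Longrightarrow> z \<le> x \<Longrightarrow> z mod N \<in> A"
proof -
  define P where "P j \<longleftrightarrow> (x - int j) mod N \<notin> A" for j
  define m where "m = (LEAST j. P j)"
  obtain z where z: "x \<le> z" "z mod N \<notin> A" using proper_gap[OF assms] .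
  \<comment> \<open>Going down by \<open>\<bar>z - x\<bar>\<close> periods, each of length at least
    1, brings the gap found above \<open>x\<close> to a place at or below \<open>x\<close>.\<close>
  define z' where "z' = z + (- \<bar>z - x\<bar>) * N"
  have "\<bar>z - x\<bar> \<le> \<bar>z - x\<bar> * N" using n2 mult_left_mono[of 1 N "\<bar>z - x\<bar>"] by simp
  then have "z' \<le> x" by (simp add: z'_def)
  moreover have "z' mod N \<notin> A" using z(2) unfolding z'_def mod_mult_self1 .
  ultimately have "P (nat (x - z'))" by (simp add: P_def)
  then have 1: "P m" unfolding m_def by (rule LeastI)
  have 2: "z mod N \<in> A" if "z \<le> x" "x - int m < z" for z
  proof -
    have "nat (x - z) < m" using that by linarith
    then have "\<not> P (nat (x - z))" unfolding m_def by (rule not_less_Least)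
    then show ?thesis using that(1) by (simp add: P_def)
  qed
  show ?thesis
    by (rule that[of "x - int m"]) (use 1 2 in \<open>simp_all add: P_def\<close>)
qed

lemma cdf_down: "(x - 1) mod N \<in> A \<Longrightarrow> cdf A x = x - 1"
  by (simp add: cdf_def)

lemma cdf_up:
  assumes "(x - 1) mod N \<notin> A" "x \<le> y" "y mod N \<notin> A" "\<And>z. x \<le> z \<Longrightarrow> z < y \<Longrightarrow> z mod N \<in> A"
  shows "cdf A x = y"
proof -
  have "(LEAST j. (x + int j) mod N \<notin> A) = nat (y - x)"
  proof (rule Least_equality)
    fix j assume "(x + int j) mod N \<notin> A"
    then have "\<not> x + int j < y" using assms(4)[of "x + int j"] by auto
    then show "nat (y - x) \<le> j" by simp
  qed (use assms in simp)
  then show ?thesis using assms by (simp add: cdf_def)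
qed

lemma cdf_upE:
  assumes A: "proper n A" and x: "(x - 1) mod N \<notin> A"
  obtains "x \<le> cdf A x" "cdf A x mod N \<notin> A" "\<And>z. x \<le> z \<Longrightarrow> z < cdf A x \<Longrightarrow> z mod N \<in> A"
proof -
  obtain y where y: "x \<le> y" "y mod N \<notin> A" "\<And>z. x \<le> z \<Longrightarrow> z < y \<Longrightarrow> z mod N \<in> A"
    using next_gap[OF A, of x] by blast
  have "cdf A x = y" by (rule cdf_up[OF x y])
  then show ?thesis using y by (intro that) simp_all
qed

lemma cdf_ge:
  assumes "proper n A" shows "x - 1 \<le> cdf A x"
proof (cases "(x - 1) mod N \<in> A")
  case False
  then show ?thesis by (rule cdf_upE[OF assms]) simp
qed (simp add: cdf_down)

lemma cdf_down_iff:
  assumes "proper n A" shows "cdf A x = x - 1 \<longleftrightarrow> (x - 1) mod N \<in> A"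
proof (cases "(x - 1) mod N \<in> A")
  case False
  then show ?thesis by (rule cdf_upE[OF assms]) (use False in simp)
qed (simp add: cdf_down)

lemma proper_mod_eq: "proper n A \<Longrightarrow> a \<in> A \<Longrightarrow> a mod N = a"
  by (auto simp: proper_def)

lemma proper_subset: "proper n A \<Longrightarrow> B \<subseteq> A \<Longrightarrow> proper n B"
  by (auto simp: proper_def)

lemma proper_finite: "proper n A \<Longrightarrow> finite A"
  using finite_subset by (auto simp: proper_def)

lemma cdf_empty: "cdf {} = id"
  by (auto simp: cdf_def)

text \<open>A letter at the top of its run may be written first, hence applied last. It then pushes
  the wire stopped at \<open>a\<close> on to the gap \<open>a + 1\<close> and lowers the wire
  waiting at \<open>a + 1\<close>.\<close>

lemma cdf_insert:
  assumes A: "proper n A" and a: "a \<in> A" "(a + 1) mod N \<notin> A"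
  shows "cdf A x = sref n a (cdf (A - {a}) x)"
proof -
  let ?B = "A - {a}"
  have B: "proper n ?B" using A by (rule proper_subset) auto
  have am: "a mod N = a" using A a proper_mod_eq by simp
  have ne: "a mod N \<noteq> (a + 1) mod N" by (rule sref_consecutive)
  consider (1) "(x - 1) mod N = a" | (2) "(x - 1) mod N \<in> ?B" | (3) "(x - 1) mod N \<notin> A" by auto
  then show ?thesis
  proof cases
    case 1
    have x: "x mod N = (a + 1) mod N" using 1 by (metis diff_add_cancel mod_add_left_eq)
    then have "cdf ?B x = x" using 1 a by (intro cdf_up) auto
    moreover have "cdf A x = x - 1" using 1 a by (intro cdf_down) simp
    ultimately show ?thesis using x ne by (simp add: sref_def tr_def)
  next
    case 2
    have "(x - 1) mod N \<noteq> a" "(x - 1) mod N \<noteq> (a + 1) mod N" using 2 a by auto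
    then show ?thesis using 2 am by (simp add: cdf_down sref_def tr_def)
  next
    case 3
    then have 3: "(x - 1) mod N \<notin> A" "(x - 1) mod N \<notin> ?B" by auto
    define y where "y = cdf ?B x"
    obtain y: "x \<le> y" "y mod N \<notin> ?B" "\<And>z. x \<le> z \<Longrightarrow> z < y \<Longrightarrow> z mod N \<in> ?B"
      using cdf_upE[OF B 3(2)] unfolding y_def by metis
    show ?thesis
    proof (cases "y mod N = a")
      case True
      have y1: "(y + 1) mod N = (a + 1) mod N" using True by (metis mod_add_left_eq)
      have "cdf A x = y + 1"
      proof (rule cdf_up)
        fix z assume "x \<le> z" "z < y + 1"
        then show "z mod N \<in> A" using y(3)[of z] True a by (cases "z = y") auto
      qed (use y y1 a 3 in auto)
      then show ?thesis using True am by (simp add: sref_def tr_def flip: y_def)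
    next
      case False
      \<comment> \<open>A wire stopping at \<open>a + 1\<close> would either have passed
        \<open>a\<close>, which is a gap of \<open>A - {a}\<close>, or have started at
        \<open>a + 1\<close> with the letter \<open>a\<close> of \<open>A\<close> just below
        it.\<close>
      have "y mod N \<noteq> (a + 1) mod N"
      proof
        assume "y mod N = (a + 1) mod N"
        then have "(y - 1) mod N = a" using am by (metis add_diff_cancel_right' mod_diff_left_eq)
        then show False using y(3)[of "y - 1"] 3 y(1) a by (cases "x = y") auto
      qed
      moreover have "cdf A x = y"
        by (rule cdf_up) (use 3 y False in auto)
      ultimately show ?thesis using False am by (simp add: sref_def tr_def flip: y_def)
    qed
  qed
qed

text \<open>The first letter \<open>a\<close> has no \<open>a + 1\<close> in \<open>A\<close>, since
  that letter would have to precede it, so \<open>cdf_insert\<close> peels it off. The value is the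
  same for all shuffles, which makes the \<open>SOME\<close> in \<open>wA\<close> harmless.\<close>

lemma word_cdf: "cd_word n A ws \<Longrightarrow> proper n A \<Longrightarrow> word n ws = cdf A"
proof (induction ws arbitrary: A)
  case Nil
  then show ?case by (simp add: cd_word_def word_def cdf_empty)
next
  case (Cons a ws)
  have c: "distinct (a # ws)" "set (a # ws) = A"
    "\<And>j. j \<in> A \<Longrightarrow> (j + 1) mod N \<in> A \<Longrightarrow> \<exists>p q. p < q \<and> q < length (a # ws) \<and>
      (a # ws) ! p = (j + 1) mod N \<and> (a # ws) ! q = j"
    using Cons.prems(1) unfolding cd_word_def by auto
  have a: "(a + 1) mod N \<notin> A"
  proof
    assume "(a + 1) mod N \<in> A"
    then obtain p q where "p < q" "q < length (a # ws)" "(a # ws) ! q = a" using c by force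
    moreover have "q = 0" using c(1) calculation by (auto simp: nth_Cons split: nat.splits)
    ultimately show False by simp
  qed
  have "cd_word n (A - {a}) ws" unfolding cd_word_def
  proof (intro conjI ballI impI)
    fix j assume j: "j \<in> A - {a}" "(j + 1) mod N \<in> A - {a}"
    then obtain p q where pq: "p < q" "q < length (a # ws)" "(a # ws) ! p = (j + 1) mod N"
      "(a # ws) ! q = j" using c(3) by blast
    then have "p > 0" using j by (cases p) auto
    then show "\<exists>p q. p < q \<and> q < length ws \<and> ws ! p = (j + 1) mod N \<and> ws ! q = j"
      using pq by (intro exI[of _ "p - 1"] exI[of _ "q - 1"]) (auto simp: nth_Cons split: nat.splits)
  qed (use c in auto)
  then have "word n ws = cdf (A - {a})"
    using Cons.IH Cons.prems(2) proper_subset by blast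
  then show ?case
    using cdf_insert[OF Cons.prems(2) _ a] c(2) by (auto simp: word_def fun_eq_iff)
qed

text \<open>Induction on the size: the top letter of some run can be put in front of a word for the
  rest.\<close>

lemma cd_word_exists: "proper n A \<Longrightarrow> \<exists>ws. cd_word n A ws"
proof (induction "card A" arbitrary: A)
  case 0
  then have "A = {}" using proper_finite by auto
  then have "cd_word n A []" by (simp add: cd_word_def)
  then show ?case by blast
next
  case (Suc k)
  then have "A \<noteq> {}" by auto
  then obtain b where b: "b \<in> A" by blast
  obtain y where y: "b \<le> y" "y mod N \<notin> A" "\<And>z. b \<le> z \<Longrightarrow> z < y \<Longrightarrow> z mod N \<in> A"
    using next_gap[OF Suc.prems] by metis
  have "y \<noteq> b" using y b Suc.prems proper_mod_eq by auto
  \<comment> \<open>As \<open>y\<close> is the first gap above \<open>b\<close>, this is the top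
    letter of the run through \<open>b\<close>.\<close>
  define a where "a = (y - 1) mod N"
  have a: "a \<in> A" using y(3)[of "y - 1"] \<open>y \<noteq> b\<close> y(1) by (simp add: a_def)
  have a1: "(a + 1) mod N \<notin> A" using y(2) by (simp add: a_def mod_simps)
  have "proper n (A - {a})" using Suc.prems proper_subset by blast
  moreover have "k = card (A - {a})" using Suc.hyps(2) a by simp
  ultimately obtain ws where ws: "cd_word n (A - {a}) ws" using Suc.hyps(1) by blast
  have wsD: "\<exists>p q. p < q \<and> q < length ws \<and> ws ! p = (j + 1) mod N \<and> ws ! q = j"
    if "j \<in> A - {a}" "(j + 1) mod N \<in> A - {a}" for j
    using ws that unfolding cd_word_def by meson
  have ws': "distinct ws" "set ws = A - {a}" using ws unfolding cd_word_def by simp_all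
  have "cd_word n A (a # ws)" unfolding cd_word_def
  proof (intro conjI ballI impI)
    fix j assume j: "j \<in> A" "(j + 1) mod N \<in> A"
    then have ja: "j \<noteq> a" using a1 by auto
    show "\<exists>p q. p < q \<and> q < length (a # ws) \<and> (a # ws) ! p = (j + 1) mod N \<and> (a # ws) ! q = j"
    proof (cases "(j + 1) mod N = a")
      case True
      have "j \<in> set ws" using ws' j ja by simp
      then obtain q where "q < length ws" "ws ! q = j" unfolding in_set_conv_nth by blast
      then show ?thesis using True by (intro exI[of _ 0] exI[of _ "Suc q"]) simp
    next
      case False
      then obtain p q where "p < q" "q < length ws" "ws ! p = (j + 1) mod N" "ws ! q = j"
        using wsD[of j] j ja by auto
      then show ?thesis by (intro exI[of _ "Suc p"] exI[of _ "Suc q"]) simp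
    qed
  qed (use ws' a in auto)
  then show ?case by blast
qed

lemma wA_cdf: "proper n A \<Longrightarrow> wA n A = cdf A"
  unfolding wA_def by (rule word_cdf[OF someI_ex[OF cd_word_exists]])

lemma equivariant_word: "equivariant (word n ws)"
proof (induction ws)
  case Nil
  then show ?case by (simp add: word_def equivariant_id[unfolded id_def])
next
  case (Cons a ws)
  have "equivariant (sref n a)"
    unfolding sref_def by (rule equivariant_tr[OF sref_consecutive])
  then have "equivariant (sref n a \<circ> word n ws)" using Cons by (rule equivariant_comp)
  moreover have "word n (a # ws) = sref n a \<circ> word n ws" by (simp add: word_def)
  ultimately show ?case by (simp only:)
qed

lemma cdf_word:
  assumes "proper n A"
  obtains ws where "length ws = card A" "set ws \<subseteq> {0..<N}" "cdf A = word n ws"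
proof -
  obtain ws where ws: "cd_word n A ws" using cd_word_exists[OF assms] by blast
  show ?thesis
  proof (rule that)
    show "length ws = card A" using ws by (auto simp: cd_word_def distinct_card)
    show "set ws \<subseteq> {0..<N}" using ws assms by (auto simp: cd_word_def proper_def)
    show "cdf A = word n ws" using word_cdf[OF ws assms] by simp
  qed
qed

lemma equivariant_cdf: "proper n A \<Longrightarrow> equivariant (cdf A)"
  by (metis cdf_word equivariant_word)

text \<open>The letters are read off from the wires that step down: \<open>a\<close> is a letter iff
  \<open>a + 1\<close> is sent to \<open>a\<close>.\<close>

lemma cdf_inj:
  assumes "proper n A" "proper n B" "cdf A = cdf B" shows "A = B"
proof -
  have *: "a \<in> A \<longleftrightarrow> a \<in> {0..<N} \<and> cdf A (a + 1) = a" if "proper n A" for A a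
    using cdf_down_iff[OF that, of "a + 1"] that by (auto simp: proper_def)
  show ?thesis using *[OF assms(1)] *[OF assms(2)] assms(3) by auto
qed

lemma cdset_wA:
  assumes "proper n A" shows "cdset n (wA n A) = A"
  unfolding cdset_def
proof (rule the_equality)
  fix B assume "proper n B \<and> wA n A = wA n B"
  then show "B = A" using assms by (metis wA_cdf cdf_inj)
qed (use assms in simp)

text \<open>No wire drops by more than one, so an inversion needs the lower wire \<open>p\<close> to
  rise past \<open>q\<close>. It rises exactly through the run of letters starting at
  \<open>p\<close>, and each wire that it passes drops by one. So the letter \<open>q - 1\<close> is
  the crossing of \<open>p\<close> and \<open>q\<close>.\<close>

lemma cdf_inv_iff:
  assumes A: "proper n A" and pq: "p < q"
  shows "cdf A q < cdf A p \<longleftrightarrow> (p - 1) mod N \<notin> A \<and> (\<forall>z. p \<le> z \<and> z < q \<longrightarrow> z mod N \<in> A)"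
proof
  assume l: "cdf A q < cdf A p"
  have p: "(p - 1) mod N \<notin> A"
  proof
    assume "(p - 1) mod N \<in> A"
    then show False using l pq cdf_ge[OF A, of q] by (simp add: cdf_down)
  qed
  have "q \<le> cdf A p" using l cdf_ge[OF A, of q] by linarith
  then show "(p - 1) mod N \<notin> A \<and> (\<forall>z. p \<le> z \<and> z < q \<longrightarrow> z mod N \<in> A)"
    using p cdf_upE[OF A p] by (smt (verit))
next
  assume r: "(p - 1) mod N \<notin> A \<and> (\<forall>z. p \<le> z \<and> z < q \<longrightarrow> z mod N \<in> A)"
  then have "cdf A q = q - 1" using pq by (intro cdf_down) auto
  moreover have "q \<le> cdf A p" using cdf_upE[OF A, of p] r by (metis linorder_not_less)
  ultimately show "cdf A q < cdf A p" by simp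
qed

text \<open>With the letter \<open>q - 1\<close> present, \<open>p\<close> rises to the next gap
  \<open>y\<close> and \<open>q\<close> drops to \<open>q - 1\<close>. Without it, \<open>p\<close>
  is stopped at \<open>q - 1\<close> and \<open>q\<close> rises to \<open>y\<close>. No wire outside
  the two classes passes this letter.\<close>

lemma cdf_remove:
  assumes A: "proper n A" and pq: "p < q" "(p - 1) mod N \<notin> A"
    and b: "\<And>z. p \<le> z \<Longrightarrow> z < q \<Longrightarrow> z mod N \<in> A"
  shows "cdf (A - {(q - 1) mod N}) = cdf A \<circ> tr n p q"
proof -
  define a where "a = (q - 1) mod N"
  let ?B = "A - {a}"
  have B: "proper n ?B" using A by (rule proper_subset) auto
  have a: "a \<in> A" using b[of "q - 1"] pq by (simp add: a_def)
  have npq: "p mod N \<noteq> q mod N"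
    using pq a by (metis a_def mod_diff_left_eq)
  obtain y where y: "q \<le> y" "y mod N \<notin> A" "\<And>z. q \<le> z \<Longrightarrow> z < y \<Longrightarrow> z mod N \<in> A"
    using next_gap[OF A] by metis
  have cong: "z mod N = a \<Longrightarrow> \<exists>k. z = q - 1 + k * N" for z
    using mod_eq_shift[of z "q - 1"] by (simp add: a_def)
  \<comment> \<open>The run from \<open>p\<close> to \<open>y\<close> avoids all translates of the
    gap \<open>p - 1\<close>, so it is shorter than a period and meets the residue \<open>a\<close>
    only at \<open>q - 1\<close>.\<close>
  have nwrap: "z mod N \<noteq> a" if "p \<le> z" "z < y" "z \<noteq> q - 1" for z
  proof
    assume za: "z mod N = a"
    then obtain k where k: "z = q - 1 + k * N" using cong by blast
    have pm: "(p - 1 + k * N) mod N \<notin> A" "(p - 1) mod N \<notin> A"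
      using pq by auto
    have kn: "k \<noteq> 0" using that k by auto
    show False
    proof (cases "k > 0")
      case True
      then have "q - 1 < p - 1 + N"
        using b[of "p - 1 + N"] pq n2 by (cases "p - 1 + N < q") auto
      moreover have "N \<le> k * N" using True by (simp add: mult_le_cancel_right1)
      ultimately have "p - 1 + N \<le> z" "q \<le> p - 1 + N" using k pq by linarith+
      then have "(p - 1 + N) mod N \<in> A" using y(3)[of "p - 1 + N"] that(2) by auto
      then show False using pm(2) by simp
    next
      case False
      then have "k * N \<le> - 1 * N" using kn by (intro mult_right_mono) auto
      then have "p \<le> q - 1 - N" using k that by simp
      then have "p \<le> p - 1 + N" "p - 1 + N < q" using n2 by auto
      then show False using b[of "p - 1 + N"] pm(2) by simp
    qed
  qed
  have cA: "cdf A p = y"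
    by (rule cdf_up) (use pq y b in \<open>auto simp: linorder_not_less\<close>, metis linorder_not_less b)
  have cq: "cdf A q = q - 1" using b[of "q - 1"] pq by (intro cdf_down) auto
  have cBp: "cdf ?B p = q - 1"
  proof (rule cdf_up)
    fix z assume z: "p \<le> z" "z < q - 1"
    then show "z mod N \<in> ?B" using b[of z] nwrap[of z] y(1) by auto
  qed (use pq in \<open>auto simp: a_def\<close>)
  have cBq: "cdf ?B q = y"
  proof (rule cdf_up)
    fix z assume z: "q \<le> z" "z < y"
    then show "z mod N \<in> ?B" using y(3)[of z] nwrap[of z] pq by auto
  qed (use y in \<open>auto simp: a_def\<close>)
  have "cdf ?B x = cdf A (tr n p q x)" for x
  proof (cases rule: tr_cases[where x = x and p = p and q = q])
    case (left k)
    then show ?thesis using cBp cq equivariant_shift[OF equivariant_cdf[OF A]]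
        equivariant_shift[OF equivariant_cdf[OF B]] by simp
  next
    case (right k)
    then show ?thesis using cBq cA npq equivariant_shift[OF equivariant_cdf[OF A]]
        equivariant_shift[OF equivariant_cdf[OF B]] by simp
  next
    case other
    have xa: "(x - 1) mod N \<noteq> a" using other(2) by (metis a_def diff_add_cancel mod_add_left_eq)
    have "cdf ?B x = cdf A x"
    proof (cases "(x - 1) mod N \<in> A")
      case True
      then show ?thesis using xa by (simp add: cdf_down)
    next
      case False
      define t where "t = cdf A x"
      obtain t: "x \<le> t" "t mod N \<notin> A" "\<And>z. x \<le> z \<Longrightarrow> z < t \<Longrightarrow> z mod N \<in> A"
        using cdf_upE[OF A False] unfolding t_def by metis
      \<comment> \<open>A rising wire that passes a translate of \<open>q - 1\<close> must start at
        the bottom of that run: from further below it would pass the translated gap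
        \<open>p - 1\<close>, and from inside the run it would step down.\<close>
      have "z mod N \<noteq> a" if z: "x \<le> z" "z < t" for z
      proof
        assume "z mod N = a"
        then obtain k where k: "z = q - 1 + k * N" using cong by blast
        have "x \<noteq> p + k * N" using other(1) by auto
        then have "x < p + k * N \<or> x > p + k * N" by linarith
        then show False
        proof
          assume "x < p + k * N"
          then have "(p - 1 + k * N) mod N \<in> A" using t(3)[of "p - 1 + k * N"] z k pq by auto
          then show False using pq by simp
        next
          assume "x > p + k * N"
          then have "(x - 1 - k * N) mod N \<in> A" using b[of "x - 1 - k * N"] z k by auto
          moreover have "(x - 1 - k * N) mod N = (x - 1) mod N" using mod_mult_self1[of "x - 1" "- k" N] by simp
          ultimately show False using False by simp
        qed
      qed
      then have "cdf ?B x = t" by (intro cdf_up) (use t False in auto)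
      then show ?thesis by (simp add: t_def)
    qed
    then show ?thesis using other by (simp add: tr_other)
  qed
  then show ?thesis by (auto simp: a_def)
qed

text \<open>The letters going down from \<open>q - 1\<close> end at \<open>p\<close>, so the new
  letter is the gap \<open>p - 1\<close>. The upper wire of a letter \<open>c\<close> sits at
  \<open>c + 1\<close>; hence the lower wire \<open>p\<close> of the old letter is the upper wire of
  the new one.\<close>

lemma Lnew_eq:
  assumes A: "proper n A" and pq: "p < q" "(p - 1) mod N \<notin> A"
    and b: "\<And>z. p \<le> z \<Longrightarrow> z < q \<Longrightarrow> z mod N \<in> A"
  shows "Lnew n A ((q - 1) mod N) = (p - 1) mod N"
proof -
  have m: "((q - 1) mod N - int k) mod N = (q - 1 - int k) mod N" for k
    by (simp add: mod_diff_left_eq)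
  \<comment> \<open>A longer run would contain the translate \<open>p - 1 + N\<close> of the gap.
    Hence the bound \<open>j < n\<close> in \<open>Ljmax\<close> does not cut the run short.\<close>
  have lt: "q - p \<le> N"
  proof (rule ccontr)
    assume "\<not> q - p \<le> N"
    then have "(p - 1 + N) mod N \<in> A" using b[of "p - 1 + N"] n2 by auto
    then show False using pq(2) by simp
  qed
  have "Ljmax n A ((q - 1) mod N) = nat (q - 1 - p)"
    unfolding Ljmax_def m
  proof (rule Greatest_equality)
    show "nat (q - 1 - p) < n \<and> (\<forall>k\<le>nat (q - 1 - p). (q - 1 - int k) mod N \<in> A)"
    proof (intro conjI allI impI)
      show "nat (q - 1 - p) < n" using lt n2 by linarith
      show "(q - 1 - int k) mod N \<in> A" if "k \<le> nat (q - 1 - p)" for k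
        using that pq by (intro b) linarith+
    qed
  next
    fix j assume j: "j < n \<and> (\<forall>k\<le>j. (q - 1 - int k) mod N \<in> A)"
    show "j \<le> nat (q - 1 - p)"
    proof (rule ccontr)
      assume "\<not> j \<le> nat (q - 1 - p)"
      then have "nat (q - p) \<le> j" by linarith
      then have "(q - 1 - int (nat (q - p))) mod N \<in> A" using j by blast
      then show False using pq by simp
    qed
  qed
  moreover have "(q - 1) mod N - int (nat (q - 1 - p)) - 1 = (q - 1) mod N - (q - p)"
    using pq by simp
  ultimately have "Lnew n A ((q - 1) mod N) = ((q - 1) mod N - (q - p)) mod N"
    unfolding Lnew_def by (simp only:)
  also have "\<dots> = (q - 1 - (q - p)) mod N" by (rule mod_diff_left_eq)
  finally show ?thesis by simp
qed

text \<open>The upper wire of \<open>a\<close> is \<open>a + 1\<close>; the lower one starts just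
  above the last gap below \<open>a\<close>. They are incongruent because \<open>p - 1\<close> is a
  gap and \<open>q - 1\<close> is a letter.\<close>

lemma element_wire:
  assumes A: "proper n A" and a: "a \<in> A"
  obtains p q where "p < q" "(p - 1) mod N \<notin> A" "\<And>z. p \<le> z \<Longrightarrow> z < q \<Longrightarrow> z mod N \<in> A"
    "q = a + 1" "a = (q - 1) mod N" "p mod N \<noteq> q mod N" "Lnew n A a = (p - 1) mod N"
proof -
  obtain y where y: "y \<le> a" "y mod N \<notin> A" "\<And>z. y < z \<Longrightarrow> z \<le> a \<Longrightarrow> z mod N \<in> A"
    using prev_gap[OF A] by blast
  have am: "a mod N = a" using A a by (rule proper_mod_eq)
  have "y \<noteq> a" using y(2) a am by auto
  have l: "Lnew n A ((a + 1 - 1) mod N) = (y + 1 - 1) mod N"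
    by (rule Lnew_eq[OF A]) (use y \<open>y \<noteq> a\<close> in auto)
  have "(y + 1) mod N \<noteq> (a + 1) mod N"
  proof
    assume "(y + 1) mod N = (a + 1) mod N"
    then have "y mod N = a mod N" by (metis add_diff_cancel_right' mod_diff_left_eq)
    then show False using y(2) a am by simp
  qed
  then show ?thesis
  proof (rule that[of "y + 1" "a + 1", rotated 5])
    show "y + 1 < a + 1" using y(1) \<open>y \<noteq> a\<close> by simp
    show "z mod N \<in> A" if "y + 1 \<le> z" "z < a + 1" for z using y(3)[of z] that by simp
  qed (use y(2) l am in simp_all)
qed

section \<open>Wires through a product of factors, their crossings, and deletion of letters\<close>

definition pr :: "int set list \<Rightarrow> int \<Rightarrow> int" where
  "pr As = foldr (\<lambda>A f. cdf A \<circ> f) As id"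

abbreviation propers :: "int set list \<Rightarrow> bool" where
  "propers As \<equiv> (\<forall>A\<in>set As. proper n A)"

abbreviation weight :: "int set list \<Rightarrow> nat" where
  "weight As \<equiv> sum_list (map card As)"

lemma pr_Nil [simp]: "pr [] = id"
  by (simp add: pr_def)

lemma pr_Cons [simp]: "pr (A # As) = cdf A \<circ> pr As"
  by (simp add: pr_def)

lemma pr_append: "pr (As @ Bs) = pr As \<circ> pr Bs"
  by (induction As) (auto simp: comp_assoc)

lemma equivariant_pr: "propers As \<Longrightarrow> equivariant (pr As)"
proof (induction As)
  case Nil
  show ?case unfolding pr_Nil by (rule equivariant_id)
next
  case (Cons A As)
  then have "equivariant (cdf A)" "equivariant (pr As)" using equivariant_cdf by simp_all
  then show ?case unfolding pr_Cons by (rule equivariant_comp)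
qed

text \<open>A wire is named by its entry position at the right end. Factors are indexed from the
  left, so level \<open>length As\<close> is the entry and level 0 the exit; factor \<open>k\<close>
  lies between the levels \<open>Suc k\<close> and \<open>k\<close>.\<close>

definition ord :: "int set list \<Rightarrow> int \<Rightarrow> int \<Rightarrow> nat \<Rightarrow> bool" where
  "ord As p q k \<longleftrightarrow> pr (drop k As) p < pr (drop k As) q"

definition crossing :: "int set list \<Rightarrow> int \<Rightarrow> int \<Rightarrow> nat \<Rightarrow> bool" where
  "crossing As p q k \<longleftrightarrow> k < length As \<and> ord As p q k \<noteq> ord As p q (Suc k)"

definition rem :: "int set list \<Rightarrow> nat \<Rightarrow> int \<Rightarrow> int set list" where
  "rem As k a = As[k := As ! k - {a}]"

lemma length_rem [simp]: "length (rem As k a) = length As"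
  by (simp add: rem_def)

lemma propers_drop: "propers As \<Longrightarrow> propers (drop k As)"
  by (meson in_set_dropD)

lemma propers_update: "propers As \<Longrightarrow> proper n B \<Longrightarrow> propers (As[k := B])"
  using set_update_subset_insert by fastforce

lemma propers_rem: "propers As \<Longrightarrow> propers (rem As k a)"
proof (cases "k < length As")
  case True
  assume "propers As"
  then show ?thesis unfolding rem_def using True
    using propers_update[of As "As ! k - {a}" k] proper_subset[of "As ! k" "As ! k - {a}"] nth_mem[of k As]
    by blast
qed (simp add: rem_def list_update_beyond)

lemma pr_drop: "k < length As \<Longrightarrow> pr (drop k As) = cdf (As ! k) \<circ> pr (drop (Suc k) As)"
  by (metis Cons_nth_drop_Suc pr_Cons)

lemma pr_split:
  "k < length As \<Longrightarrow> pr (As[k := B]) = pr (take k As) \<circ> cdf B \<circ> pr (drop (Suc k) As)"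
  by (simp add: upd_conv_take_nth_drop pr_append comp_assoc)

lemma pr_split':
  assumes "k < length As"
  shows "pr As = pr (take k As) \<circ> cdf (As ! k) \<circ> pr (drop (Suc k) As)"
  using pr_split[OF assms, of "As ! k"] by simp

lemma ord_sym:
  assumes "propers As" "p mod N \<noteq> q mod N"
  shows "ord As q p k \<longleftrightarrow> \<not> ord As p q k"
proof -
  have "p \<noteq> q" using assms by auto
  then have "pr (drop k As) p \<noteq> pr (drop k As) q"
    using equivariant_eq_iff[OF equivariant_pr[OF propers_drop[OF assms(1)]]] by simp
  then show ?thesis by (auto simp: ord_def)
qed

lemma crossing_sym:
  assumes "propers As" "p mod N \<noteq> q mod N"
  shows "crossing As q p k \<longleftrightarrow> crossing As p q k"
  using ord_sym[OF assms] by (auto simp: crossing_def)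

text \<open>The reflection produced inside factor \<open>k\<close> is moved to the right end by
  conjugation with the factors after it.\<close>

lemma pr_rem:
  assumes P: "propers As" and k: "k < length As" and pq: "p mod N \<noteq> q mod N"
    and c: "cdf (As ! k - {a}) = cdf (As ! k) \<circ> tr n (pr (drop (Suc k) As) p) (pr (drop (Suc k) As) q)"
  shows "pr (rem As k a) = pr As \<circ> tr n p q"
proof -
  let ?u = "pr (drop (Suc k) As)"
  have u: "equivariant ?u" by (rule equivariant_pr[OF propers_drop[OF P]])
  show ?thesis
    unfolding rem_def pr_split[OF k] pr_split'[OF k] c comp_assoc tr_conj_comp[OF u pq] ..
qed

text \<open>A crossing of wires that arrive in the order \<open>u p < u q\<close> is an inversion of
  the factor, so \<open>u p\<close> is the bottom of a run reaching to \<open>u q\<close>, and the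
  letter just below \<open>u q\<close> is the crossing.\<close>

lemma crossing_removal:
  assumes P: "propers As" and pq: "p mod N \<noteq> q mod N" and c: "crossing As p q k"
    and u: "u = pr (drop (Suc k) As)" and l: "u p < u q" and a: "a = (u q - 1) mod N"
  shows "a \<in> As ! k" "Lnew n (As ! k) a = (u p - 1) mod N" "pr (rem As k a) = pr As \<circ> tr n p q"
proof -
  have k: "k < length As" using c by (simp add: crossing_def)
  have A: "proper n (As ! k)" using P k by simp
  have "\<not> cdf (As ! k) (u p) < cdf (As ! k) (u q)"
    using c l by (auto simp: crossing_def ord_def pr_drop u)
  moreover have "cdf (As ! k) (u p) \<noteq> cdf (As ! k) (u q)"
    using equivariant_eq_iff[OF equivariant_cdf[OF A]] l by simp
  ultimately have "cdf (As ! k) (u q) < cdf (As ! k) (u p)" by simp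
  then have i: "(u p - 1) mod N \<notin> As ! k" "\<And>z. u p \<le> z \<Longrightarrow> z < u q \<Longrightarrow> z mod N \<in> As ! k"
    using cdf_inv_iff[OF A l] by auto
  show "a \<in> As ! k" using i(2)[of "u q - 1"] l a by simp
  show "Lnew n (As ! k) a = (u p - 1) mod N" unfolding a by (rule Lnew_eq[OF A l i])
  show "pr (rem As k a) = pr As \<circ> tr n p q"
    by (rule pr_rem[OF P k pq]) (use cdf_remove[OF A l i] in \<open>simp add: a u\<close>)
qed

text \<open>Converse of \<open>crossing_removal\<close>. Cancelling the factors on both sides shows
  that the reflection of the two wires of \<open>a\<close> is the one in \<open>u p\<close> and
  \<open>u q\<close>, so by \<open>tr_eqD\<close> these are the wires of \<open>a\<close> up to a
  shift.\<close>

lemma removal_crossing: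
  assumes P: "propers As" and pq: "p mod N \<noteq> q mod N" and k: "k < length As"
    and a: "a \<in> As ! k" and e: "pr (rem As k a) = pr As \<circ> tr n p q"
  shows "crossing As p q k"
    and "pr (drop (Suc k) As) p < pr (drop (Suc k) As) q \<Longrightarrow> a = (pr (drop (Suc k) As) q - 1) mod N"
proof -
  define u where "u = pr (drop (Suc k) As)"
  have A: "proper n (As ! k)" using P k by simp
  have u: "equivariant u" unfolding u_def by (rule equivariant_pr[OF propers_drop[OF P]])
  have cA: "equivariant (cdf (As ! k))" by (rule equivariant_cdf[OF A])
  obtain p' q' where w: "p' < q'" "(p' - 1) mod N \<notin> As ! k"
    "\<And>z. p' \<le> z \<Longrightarrow> z < q' \<Longrightarrow> z mod N \<in> As ! k" and aq: "a = (q' - 1) mod N"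
    using element_wire[OF A a] by metis
  have upq: "u p mod N \<noteq> u q mod N" using equivariant_mod_iff[OF u] pq by simp
  have "equivariant (pr (take k As))" using P by (intro equivariant_pr) (meson in_set_takeD)
  then have "inj (pr (take k As) \<circ> cdf (As ! k))"
    using equivariant_comp cA by (auto simp: equivariant_def bij_def)
  moreover have "pr (take k As) \<circ> cdf (As ! k) \<circ> (tr n p' q' \<circ> u)
      = pr (take k As) \<circ> cdf (As ! k) \<circ> (tr n (u p) (u q) \<circ> u)"
  proof -
    have "cdf (As ! k - {a}) = cdf (As ! k) \<circ> tr n p' q'"
      unfolding aq by (rule cdf_remove[OF A w])
    then have "pr (rem As k a) = pr (take k As) \<circ> (cdf (As ! k) \<circ> (tr n p' q' \<circ> u))"
      unfolding rem_def pr_split[OF k] by (simp only: comp_assoc u_def)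
    moreover have "pr As \<circ> tr n p q = pr (take k As) \<circ> (cdf (As ! k) \<circ> (tr n (u p) (u q) \<circ> u))"
      unfolding pr_split'[OF k] u_def[symmetric] comp_assoc tr_conj_comp[OF u pq] ..
    ultimately show ?thesis using e by (simp only: comp_assoc)
  qed
  ultimately have "tr n p' q' \<circ> u = tr n (u p) (u q) \<circ> u"
    by (simp add: fun.inj_map_strong inj_def fun_eq_iff)
  moreover have "surj u" using u by (auto simp: equivariant_def bij_def)
  ultimately have t: "tr n (u p) (u q) = tr n p' q'"
    by (metis fun_eq_iff comp_apply surjD)
  obtain m where m: "u p = p' + m * N \<and> u q = q' + m * N \<or> u p = q' + m * N \<and> u q = p' + m * N"
    using tr_eqD[OF upq t] by blast
  have "cdf (As ! k) q' < cdf (As ! k) p'" using cdf_inv_iff[OF A w(1)] w by blast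
  then have "(u p < u q) \<noteq> (cdf (As ! k) (u p) < cdf (As ! k) (u q))"
    using m w(1) equivariant_shift[OF cA] by auto
  then show "crossing As p q k" using k by (auto simp: crossing_def ord_def pr_drop u_def)
  show "a = (pr (drop (Suc k) As) q - 1) mod N" if "pr (drop (Suc k) As) p < pr (drop (Suc k) As) q"
  proof -
    have "u q = q' + m * N" using that m w(1) by (auto simp: u_def)
    then have "u q - 1 = q' - 1 + m * N" by simp
    then show ?thesis unfolding aq u_def[symmetric] by (simp only: mod_mult_self1)
  qed
qed

text \<open>Within a factor the letter is forced: it lies just below the upper one of the two
  wires.\<close>

lemma removal_unique:
  assumes P: "propers As" and pq: "p mod N \<noteq> q mod N" and k: "k < length As"
    and "a \<in> As ! k" "pr (rem As k a) = pr As \<circ> tr n p q"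
    and "b \<in> As ! k" "pr (rem As k b) = pr As \<circ> tr n p q"
  shows "a = b"
proof -
  let ?u = "pr (drop (Suc k) As)"
  have "p \<noteq> q" using pq by auto
  then have "?u p \<noteq> ?u q"
    using equivariant_eq_iff[OF equivariant_pr[OF propers_drop[OF P]]] by simp
  then consider "?u p < ?u q" | "?u q < ?u p" by linarith
  then show ?thesis
    by cases (use removal_crossing(2)[OF P] removal_crossing(2)[OF P pq[symmetric]]
        tr_commute[OF pq] assms in metis)+
qed

lemma crossing_removal_ex:
  assumes P: "propers As" and pq: "p mod N \<noteq> q mod N" and c: "crossing As p q k"
  obtains a where "a \<in> As ! k" "pr (rem As k a) = pr As \<circ> tr n p q"
proof (cases "pr (drop (Suc k) As) p < pr (drop (Suc k) As) q")
  case True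
  then show ?thesis using crossing_removal[OF P pq c] that by blast
next
  case False
  have "p \<noteq> q" using pq by auto
  then have "pr (drop (Suc k) As) p \<noteq> pr (drop (Suc k) As) q"
    using equivariant_eq_iff[OF equivariant_pr[OF propers_drop[OF P]]] by simp
  then have "pr (drop (Suc k) As) q < pr (drop (Suc k) As) p" using False by simp
  moreover have "crossing As q p k" using c crossing_sym[OF P pq] by simp
  ultimately show ?thesis
    using crossing_removal[OF P pq[symmetric]] that tr_commute[OF pq] by metis
qed

lemma ord_rem_after: "k < j \<Longrightarrow> ord (rem As k a) p q j = ord As p q j"
  by (simp add: ord_def rem_def)

text \<open>Left of the deleted letter each of the two wires runs where the other one did: the
  untouched factors \<open>take j As\<close> cancel from the product and leave the
  reflection.\<close>

lemma ord_rem_before: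
  assumes P: "propers As" and pq: "p mod N \<noteq> q mod N" and k: "k < length As"
    and e: "pr (rem As k a) = pr As \<circ> tr n p q" and j: "j \<le> k"
  shows "ord (rem As k a) p q j = ord As q p j"
proof -
  let ?d = "\<lambda>As. pr (drop j As)"
  have t: "take j (rem As k a) = take j As" using j by (simp add: rem_def)
  have d: "pr Bs = pr (take j Bs) \<circ> ?d Bs" for Bs
    using pr_append[of "take j Bs" "drop j Bs"] by simp
  have "pr (take j As) \<circ> ?d (rem As k a) = pr (take j As) \<circ> (?d As \<circ> tr n p q)"
    using e d[of As] d[of "rem As k a"] by (simp only: t comp_assoc)
  moreover have "equivariant (pr (take j As))" using P by (intro equivariant_pr) (meson in_set_takeD)
  ultimately have "?d (rem As k a) x = (?d As \<circ> tr n p q) x" for x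
    using equivariant_eq_iff[of "pr (take j As)"] by (simp add: fun_eq_iff)
  then show ?thesis using pq by (simp add: ord_def)
qed

text \<open>Deletion at most exchanges the names of the two wires at the other factors, and being a
  crossing is symmetric in the names.\<close>

lemma crossing_rem:
  assumes P: "propers As" and pq: "p mod N \<noteq> q mod N" and k: "k < length As"
    and e: "pr (rem As k a) = pr As \<circ> tr n p q" and j: "j \<noteq> k"
  shows "crossing (rem As k a) p q j = crossing As p q j"
proof (cases "j < k")
  case True
  then have "crossing (rem As k a) p q j = crossing As q p j"
    using ord_rem_before[OF P pq k e] by (auto simp: crossing_def)
  then show ?thesis using crossing_sym[OF P pq] by simp
qed (use j in \<open>auto simp: crossing_def ord_rem_after\<close>)

lemma weight_rem:
  assumes "propers As" "k < length As" "a \<in> As ! k"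
  shows "Suc (weight (rem As k a)) = weight As"
proof -
  have f: "finite (As ! k)" using assms by (intro proper_finite) auto
  have s: "map card (rem As k a) = (map card As)[k := card (As ! k) - 1]"
    using f assms(3) by (simp add: rem_def map_update)
  have "card (As ! k) \<le> weight As"
    using assms(2) elem_le_sum_list[of k "map card As"] by simp
  moreover have "card (As ! k) > 0" using f assms(3) card_gt_0_iff by blast
  ultimately show ?thesis unfolding s using assms(2) by (simp add: sum_list_update)
qed

section \<open>Length\<close>

text \<open>Membership in the group generated by the simple reflections, which guarantees that the
  \<open>LEAST\<close> in \<open>len\<close> is attained.\<close>

definition is_word :: "(int \<Rightarrow> int) \<Rightarrow> bool" where
  "is_word w \<longleftrightarrow> (\<exists>ws. set ws \<subseteq> {0..<N} \<and> w = word n ws)"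

lemma word_append: "word n (xs @ ys) = word n xs \<circ> word n ys"
  by (induction xs) (auto simp: word_def comp_assoc)

lemma is_word_comp:
  assumes "is_word f" "is_word g" shows "is_word (f \<circ> g)"
proof -
  obtain xs ys where "set xs \<subseteq> {0..<N}" "f = word n xs" "set ys \<subseteq> {0..<N}" "g = word n ys"
    using assms by (auto simp: is_word_def)
  then show ?thesis unfolding is_word_def by (intro exI[of _ "xs @ ys"]) (simp add: word_append)
qed

lemma pr_word:
  assumes "propers As"
  shows "\<exists>ws. length ws = weight As \<and> set ws \<subseteq> {0..<N} \<and> pr As = word n ws"
  using assms
proof (induction As)
  case Nil
  then show ?case by (intro exI[of _ "[]"]) (simp add: word_def)
next
  case (Cons A As)
  then obtain ws where "length ws = weight As" "set ws \<subseteq> {0..<N}" "pr As = word n ws" by auto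
  moreover obtain xs where "length xs = card A" "set xs \<subseteq> {0..<N}" "cdf A = word n xs"
    using cdf_word Cons.prems by (metis list.set_intros(1))
  ultimately show ?case by (intro exI[of _ "xs @ ws"]) (simp add: word_append)
qed

lemma len_pr_le: "propers As \<Longrightarrow> len n (pr As) \<le> weight As"
  unfolding len_def by (rule Least_le) (rule pr_word)

lemma is_word_pr: "propers As \<Longrightarrow> is_word (pr As)"
  using pr_word unfolding is_word_def by blast

lemma proper_singleton: "i \<in> {0..<N} \<Longrightarrow> proper n {i}"
proof -
  assume i: "i \<in> {0..<N}"
  have "0 \<in> {0..<N}" "1 \<in> {0..<N}" using n2 by auto
  then have "{i} \<noteq> {0..<N}" by (metis singletonD zero_neq_one)
  then show ?thesis using i by (simp add: proper_def psubset_eq)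
qed

lemma cdf_singleton:
  assumes i: "i \<in> {0..<N}" shows "cdf {i} = sref n i"
proof -
  have "(i + 1) mod N \<notin> {i}" using sref_consecutive[of i] i by auto
  then show ?thesis using cdf_insert[OF proper_singleton[OF i], of i] by (auto simp: cdf_empty)
qed

lemma word_pr: "set ws \<subseteq> {0..<N} \<Longrightarrow> word n ws = pr (map (\<lambda>i. {i}) ws)"
  by (induction ws) (auto simp: word_def cdf_singleton)

text \<open>A reduced word is viewed as a tuple of singletons, so that the results on wires apply to
  ordinary words.\<close>

lemma len_attained:
  assumes "is_word w" obtains As where "propers As" "weight As = len n w" "pr As = w"
proof -
  have "\<exists>k ws. length ws = k \<and> set ws \<subseteq> {0..<N} \<and> w = word n ws"
    using assms by (auto simp: is_word_def)
  from LeastI_ex[OF this] obtain ws where ws: "length ws = len n w" "set ws \<subseteq> {0..<N}" "w = word n ws"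
    unfolding len_def by blast
  have "sum_list (map card (map (\<lambda>i. {i}) ws)) = length ws" by (induction ws) auto
  then show ?thesis
    using ws proper_singleton word_pr[of ws] by (intro that[of "map (\<lambda>i. {i}) ws"]) auto
qed

lemma is_word_sref: "is_word (tr n i (i + 1))"
proof -
  have "tr n i (i + 1) = sref n (i mod N)"
    using tr_shift[of "i mod N" "i div N" "i mod N + 1"] by (simp add: sref_def algebra_simps)
  also have "\<dots> = word n [i mod N]" by (simp add: word_def)
  finally show ?thesis unfolding is_word_def using n2 by (intro exI[of _ "[i mod N]"]) simp
qed

text \<open>Induction on the distance: conjugating by the simple reflection \<open>s\<close> that
  exchanges \<open>q - 1\<close> and \<open>q\<close> reduces to a closer pair.\<close>

lemma is_word_tr_less: "p < q \<Longrightarrow> p mod N \<noteq> q mod N \<Longrightarrow> is_word (tr n p q)"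
proof (induction "nat (q - p)" arbitrary: p q rule: less_induct)
  case less
  define s where "s = tr n (q - 1) q"
  have c: "(q - 1) mod N \<noteq> q mod N" using sref_consecutive[of "q - 1"] by simp
  have ws: "is_word s" using is_word_sref[of "q - 1"] by (simp add: s_def)
  have es: "equivariant s" unfolding s_def by (rule equivariant_tr[OF c])
  have conj: "is_word (tr n p q)"
    if "p' < q'" "q' - p' < q - p" "p' mod N \<noteq> q' mod N" "s p' = p" "s q' = q" for p' q'
  proof -
    have "s \<circ> tr n p' q' \<circ> s = tr n p q \<circ> s \<circ> s"
      using tr_conj_comp[OF es that(3)] that by simp
    also have "\<dots> = tr n p q" unfolding s_def using c by simp
    finally show ?thesis using less.hyps[of q' p'] that ws less.prems
      by (metis is_word_comp zless_nat_conj diff_gt_0_iff_gt)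
  qed
  show ?case
  proof (cases "q = p + 1")
    case True
    then show ?thesis using is_word_sref by simp
  next
    case False
    then have q: "p + 1 < q" using less.prems by simp
    show ?thesis
    proof (cases "p mod N = (q - 1) mod N")
      case True
      \<comment> \<open>Here \<open>s\<close> moves \<open>p\<close> as well, since \<open>p\<close>
        is a translate of \<open>q - 1\<close>. The pair to be conjugated is therefore
        \<open>p + 1\<close>, \<open>q - 1\<close>, and \<open>n >= 2\<close> keeps its members in
        order.\<close>
      then obtain k where k: "q - 1 = p + k * N" using mod_eq_shift by metis
      then have "k > 0" using q n2 by (smt (verit) mult_nonpos_nonneg of_nat_0_le_iff)
      then have "1 * N \<le> k * N" by (intro mult_right_mono) simp_all
      then have "q - 1 > p + 1" using k n2 by linarith
      moreover have "(p + 1) mod N \<noteq> (q - 1) mod N"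
        using True c by (metis diff_add_cancel mod_add_left_eq)
      moreover have "s (p + 1) = p"
        using tr_right[OF c, of "- k"] k by (simp add: s_def algebra_simps)
      ultimately show ?thesis by (intro conj[of "p + 1" "q - 1"]) (simp_all add: s_def)
    next
      case False
      then show ?thesis using q less.prems
        by (intro conj[of p "q - 1"]) (simp_all add: s_def tr_other)
    qed
  qed
qed

lemma is_word_tr: "p mod N \<noteq> q mod N \<Longrightarrow> is_word (tr n p q)"
  using is_word_tr_less[of p q] is_word_tr_less[of q p] tr_commute[of p q]
  by (cases p q rule: linorder_cases) auto

lemma ord_constant:
  assumes "i \<le> j" "j \<le> length As" "\<And>k. i \<le> k \<Longrightarrow> k < j \<Longrightarrow> \<not> crossing As p q k"
  shows "ord As p q i = ord As p q j"
  using assms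
proof (induction j)
  case (Suc j)
  then show ?case by (cases "i = Suc j") (auto simp: crossing_def)
qed simp

lemma ord_length: "ord As p q (length As) \<longleftrightarrow> p < q"
  by (simp add: ord_def)

lemma ord_0: "ord As p q 0 \<longleftrightarrow> pr As p < pr As q"
  by (simp add: ord_def)

text \<open>Strong exchange: in a reduced word of the product the wires \<open>p\<close> and
  \<open>q\<close> enter in order and leave reversed, so they cross. Deleting that crossing leaves a
  word for \<open>v\<close> with one letter less.\<close>

lemma len_tr_greater:
  assumes v: "is_word v" and pq: "p < q" "p mod N \<noteq> q mod N" and vpq: "v p < v q"
  shows "len n v < len n (v \<circ> tr n p q)"
proof -
  let ?w = "v \<circ> tr n p q"
  have "is_word ?w" using v is_word_tr[OF pq(2)] by (rule is_word_comp)
  then obtain As where As: "propers As" "weight As = len n ?w" "pr As = ?w" using len_attained by blast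
  have "\<not> ord As p q 0" unfolding ord_0 using As(3) vpq pq by simp
  then obtain k where k: "crossing As p q k"
    using ord_constant[of 0 "length As" As p q] ord_length pq by auto
  then have kl: "k < length As" by (simp add: crossing_def)
  obtain a where a: "a \<in> As ! k" "pr (rem As k a) = pr As \<circ> tr n p q"
    using crossing_removal_ex[OF As(1) pq(2) k] by blast
  have "pr (rem As k a) = v" using a(2) As(3) pq by simp
  then have "len n v \<le> weight (rem As k a)" using len_pr_le propers_rem As(1) by metis
  then show ?thesis using weight_rem[OF As(1) kl a(1)] As(2) by simp
qed

text \<open>Deleting two crossings of one pair multiplies by the same reflection twice, so the
  product would be reached with two letters fewer.\<close>

lemma reduced_crossing_unique:
  assumes P: "propers As" and pq: "p mod N \<noteq> q mod N" and r: "weight As \<le> len n (pr As)"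
    and c: "crossing As p q j" "crossing As p q k"
  shows "j = k"
proof (rule ccontr)
  assume jk: "j \<noteq> k"
  have kl: "k < length As" "j < length As" using c by (simp_all add: crossing_def)
  obtain a where a: "a \<in> As ! k" "pr (rem As k a) = pr As \<circ> tr n p q"
    using crossing_removal_ex[OF P pq c(2)] by blast
  let ?B = "rem As k a"
  have B: "propers ?B" by (rule propers_rem[OF P])
  have "crossing ?B p q j" using crossing_rem[OF P pq kl(1) a(2) jk] c by simp
  then obtain b where b: "b \<in> ?B ! j" "pr (rem ?B j b) = pr ?B \<circ> tr n p q"
    using crossing_removal_ex[OF B pq] by blast
  have "pr (rem ?B j b) = pr As" using b(2) a(2) pq by simp
  then have "len n (pr As) \<le> weight (rem ?B j b)" using len_pr_le propers_rem B by metis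
  moreover have "Suc (weight (rem ?B j b)) = weight ?B" using weight_rem[OF B _ b(1)] kl by simp
  moreover have "Suc (weight ?B) = weight As" by (rule weight_rem[OF P kl(1) a(1)])
  ultimately show False using r by simp
qed

text \<open>The word of \<open>A\<close> gives the upper bound. For the lower one, deleting a letter
  removes the inversion of its two wires, so by \<open>len_tr_greater\<close> the length falls
  strictly.\<close>

lemma len_cdf: "proper n A \<Longrightarrow> len n (cdf A) = card A"
proof (induction "card A" arbitrary: A)
  case 0
  then show ?case using len_pr_le[of "[A]"] by simp
next
  case (Suc k)
  then have "A \<noteq> {}" by auto
  then obtain a where a: "a \<in> A" by blast
  then obtain p q where w: "p < q" "(p - 1) mod N \<notin> A" "\<And>z. p \<le> z \<Longrightarrow> z < q \<Longrightarrow> z mod N \<in> A"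
    "a = (q - 1) mod N" "p mod N \<noteq> q mod N" using element_wire[OF Suc.prems] by metis
  have B: "proper n (A - {a})" using Suc.prems proper_subset by blast
  have k: "k = card (A - {a})" using Suc.hyps(2) a by simp
  have e: "cdf (A - {a}) = cdf A \<circ> tr n p q" unfolding w(4) by (rule cdf_remove[OF Suc.prems w(1-3)])
  have "cdf A q < cdf A p" using cdf_inv_iff[OF Suc.prems w(1)] w by blast
  then have "cdf (A - {a}) p < cdf (A - {a}) q" using w(5) by (simp add: e)
  moreover have "is_word (cdf (A - {a}))" using is_word_pr[of "[A - {a}]"] B by simp
  ultimately have "len n (cdf (A - {a})) < len n (cdf (A - {a}) \<circ> tr n p q)"
    using w by (intro len_tr_greater) auto
  moreover have "cdf (A - {a}) \<circ> tr n p q = cdf A" using w(5) by (simp add: e)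
  moreover have "len n (cdf A) \<le> card A" using len_pr_le[of "[A]"] Suc.prems by simp
  ultimately show ?case using Suc.hyps(1)[OF k B] Suc.hyps(2) k by simp
qed

end

section \<open>Alternating orbits\<close>

text \<open>A relation and not a recursive function, because termination is a result about finite
  sets, not a feature of \<open>L\<close> and \<open>\<phi>\<close>.\<close>

inductive alternating :: "('a \<Rightarrow> 'a) \<Rightarrow> ('a \<Rightarrow> 'a) \<Rightarrow> 'a set \<Rightarrow> 'a \<Rightarrow> 'a \<Rightarrow> bool" for L \<phi> R where
  stop: "L x \<in> R \<Longrightarrow> alternating L \<phi> R x (L x)"
| continue: "L x \<notin> R \<Longrightarrow> alternating L \<phi> R (\<phi> (L x)) y \<Longrightarrow> alternating L \<phi> R x y"

lemma alternating_unique: "alternating L \<phi> R x y \<Longrightarrow> alternating L \<phi> R x z \<Longrightarrow> y = z"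
proof (induction arbitrary: z rule: alternating.induct)
  case (stop x)
  from stop(2,1) show ?case by cases auto
next
  case (continue x y)
  from continue(4,1) have "alternating L \<phi> R (\<phi> (L x)) z" by cases auto
  then show ?case by (rule continue.IH)
qed

context
  fixes L \<phi> :: "'a \<Rightarrow> 'a" and X Y R :: "'a set"
  assumes fin: "finite X" and L: "bij_betw L X Y" and \<phi>: "bij_betw \<phi> (Y - R) (X - R)"
begin

lemma alternating_image: "alternating L \<phi> R x y \<Longrightarrow> x \<in> X \<Longrightarrow> y \<in> Y \<inter> R"
proof (induction rule: alternating.induct)
  case (stop x)
  then show ?case using bij_betwE[OF L] by blast
next
  case (continue x y)
  then have "\<phi> (L x) \<in> X" using bij_betwE[OF L] bij_betwE[OF \<phi>] by blast
  then show ?case by (rule continue.IH)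
qed

lemma alternating_inj: "inj_on (\<lambda>x. \<phi> (L x)) {x \<in> X. L x \<notin> R}"
proof (rule inj_onI)
  fix x y assume xy: "x \<in> {x \<in> X. L x \<notin> R}" "y \<in> {x \<in> X. L x \<notin> R}" "\<phi> (L x) = \<phi> (L y)"
  then have "L x \<in> Y - R" "L y \<in> Y - R" using bij_betwE[OF L] by blast+
  then have "L x = L y" using xy(3) \<phi> unfolding bij_betw_def by (meson inj_onD)
  then show "x = y" using xy(1,2) L unfolding bij_betw_def by (auto dest: inj_onD)
qed

text \<open>On the finite set of points whose orbit never stops, the injection \<open>\<phi> \<circ> L\<close> is a
  permutation, so these points all lie in its range and hence outside \<open>R\<close>.\<close>

lemma alternating_exists:
  assumes "x \<in> X \<inter> R" shows "\<exists>y. alternating L \<phi> R x y"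
proof (rule ccontr)
  assume *: "\<nexists>y. alternating L \<phi> R x y"
  define U where "U = {x \<in> X. \<nexists>y. alternating L \<phi> R x y}"
  have UR: "L x \<notin> R" "\<nexists>y. alternating L \<phi> R (\<phi> (L x)) y" if "x \<in> U" for x
    using that alternating.intros[of L _ R \<phi>] by (auto simp: U_def)
  have g: "\<phi> (L x) \<in> X - R" if "x \<in> U" for x
    using UR(1)[OF that] that bij_betwE[OF L] bij_betwE[OF \<phi>] unfolding U_def by blast
  have "(\<lambda>x. \<phi> (L x)) ` U = U"
  proof (rule endo_inj_surj)
    show "finite U" using fin by (simp add: U_def)
    show "(\<lambda>x. \<phi> (L x)) ` U \<subseteq> U" using g UR(2) by (auto simp: U_def)
    show "inj_on (\<lambda>x. \<phi> (L x)) U"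
      by (rule inj_on_subset[OF alternating_inj]) (use UR(1) in \<open>auto simp: U_def\<close>)
  qed
  moreover have "x \<in> U" using * assms by (simp add: U_def)
  ultimately obtain x' where "x' \<in> U" "x = \<phi> (L x')" by blast
  then show False using g assms by blast
qed

text \<open>Let \<open>E\<close> be the set of points leading to \<open>y\<close>. Were none of them
  in \<open>R\<close>, each would be the image under the injection of a point of \<open>E\<close>
  that does not stop at once. Counting shows that no point of \<open>E\<close> stops at once,
  against the preimage of \<open>y\<close> under \<open>L\<close>.\<close>

lemma alternating_onto:
  assumes "y \<in> Y \<inter> R" shows "\<exists>x \<in> X \<inter> R. alternating L \<phi> R x y"
proof (rule ccontr)
  assume *: "\<not> ?thesis"
  define E where "E = {x \<in> X. alternating L \<phi> R x y}"
  define E' where "E' = {x \<in> E. L x \<notin> R}"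
  have finE: "finite E" using fin by (simp add: E_def)
  have "E \<subseteq> (\<lambda>x. \<phi> (L x)) ` E'"
  proof
    fix x assume x: "x \<in> E"
    then have "x \<in> X - R" using * by (auto simp: E_def)
    then obtain z where z: "z \<in> Y - R" "x = \<phi> z" using \<phi> unfolding bij_betw_def by blast
    then obtain x' where x': "x' \<in> X" "z = L x'" using L unfolding bij_betw_def by blast
    have "alternating L \<phi> R x' y"
      by (rule alternating.continue) (use x z x' in \<open>auto simp: E_def\<close>)
    then show "x \<in> (\<lambda>x. \<phi> (L x)) ` E'" using x' z by (auto simp: E_def E'_def)
  qed
  moreover have finE': "finite E'" using finE by (simp add: E'_def)
  ultimately have "card E \<le> card E'"
    using card_mono[OF finite_imageI[OF finE']] card_image_le[OF finE'] by (meson order_trans)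
  moreover have "E' \<subseteq> E" by (auto simp: E'_def)
  ultimately have "E' = E" using finE by (simp add: card_seteq)
  moreover obtain x where x: "x \<in> X" "y = L x" using assms L unfolding bij_betw_def by blast
  moreover have "alternating L \<phi> R x (L x)" by (rule alternating.stop) (use x assms in simp)
  ultimately have "x \<in> E'" by (simp add: E_def)
  then show False using x assms by (simp add: E'_def)
qed

text \<open>Injectivity is by counting: \<open>X\<close> and \<open>Y\<close> have equal size, and
  so do their parts outside \<open>R\<close>, hence also the parts inside \<open>R\<close>. A
  surjection between the latter is a bijection.\<close>

lemma alternating_bij_betw: "bij_betw (\<lambda>x. THE y. alternating L \<phi> R x y) (X \<inter> R) (Y \<inter> R)"
proof -
  let ?f = "\<lambda>x. THE y. alternating L \<phi> R x y"
  have f: "?f x = y" if "alternating L \<phi> R x y" for x y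
    using that alternating_unique by (intro the_equality)
  have img: "?f ` (X \<inter> R) = Y \<inter> R"
  proof
    show "?f ` (X \<inter> R) \<subseteq> Y \<inter> R"
    proof
      fix y assume "y \<in> ?f ` (X \<inter> R)"
      then obtain x where x: "x \<in> X \<inter> R" "y = ?f x" by blast
      obtain z where "alternating L \<phi> R x z" using alternating_exists[OF x(1)] by blast
      then show "y \<in> Y \<inter> R" using f alternating_image x by (metis IntD1)
    qed
    show "Y \<inter> R \<subseteq> ?f ` (X \<inter> R)"
    proof
      fix y assume "y \<in> Y \<inter> R"
      from alternating_onto[OF this] obtain x where "x \<in> X \<inter> R" "alternating L \<phi> R x y" by blast
      then show "y \<in> ?f ` (X \<inter> R)" using f[of x y] by (metis imageI)
    qed
  qed
  have finY: "finite Y" using bij_betw_finite[OF L] fin by simp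
  have "card X = card Y" "card (X - R) = card (Y - R)"
    using bij_betw_same_card[OF L] bij_betw_same_card[OF \<phi>] by simp_all
  then have "card (X \<inter> R) = card (Y \<inter> R)"
    using card_Int_Diff[OF fin, of R] card_Int_Diff[OF finY, of R] by linarith
  then have "inj_on ?f (X \<inter> R)" using fin by (intro eq_card_imp_inj_on) (simp_all add: img)
  then show ?thesis using img by (simp add: bij_betw_def)
qed

end

context affine
begin

section \<open>Marked decompositions\<close>

text \<open>Letter sets stand in for the permutations; \<open>cdf_inj\<close> and
  \<open>len_cdf\<close> make this faithful, with \<open>card\<close> as the length of a
  factor.\<close>

definition marked :: "nat list \<Rightarrow> (int \<Rightarrow> int) \<Rightarrow> (int set list \<times> nat \<times> int) set" where
  "marked \<alpha> v = {(As, k, a). propers As \<and> map card As = \<alpha> \<and> k < length As \<and> a \<in> As ! k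
     \<and> pr (rem As k a) = v}"

text \<open>The marked letter is a crossing of two wires; \<open>low r\<close> and \<open>high r\<close> say that the wire
  entering at position \<open>r\<close> is the lower, respectively the upper, of the two before it crosses.\<close>

definition low :: "int \<Rightarrow> (int set list \<times> nat \<times> int) set" where
  "low r = {(As, k, a). (pr (drop (Suc k) As) r - 1) mod N = Lnew n (As ! k) a}"

definition high :: "int \<Rightarrow> (int set list \<times> nat \<times> int) set" where
  "high r = {(As, k, a). (pr (drop (Suc k) As) r - 1) mod N = a}"

definition reduced :: "(int set list \<times> nat \<times> int) set" where
  "reduced = {(As, k, a). len n (pr As) = weight As}"

definition Lshift :: "int set list \<times> nat \<times> int \<Rightarrow> int set list \<times> nat \<times> int" where
  "Lshift = (\<lambda>(As, k, a). (As[k := Lmap n (As ! k) a], k, Lnew n (As ! k) a))"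

text \<open>A letter fixes its two wires only up to a common shift. The free \<open>m\<close> lets
  either of them be normalised to a prescribed wire \<open>r\<close>.\<close>

lemma marked_wires:
  assumes P: "propers As" and k: "k < length As" and a: "a \<in> As ! k"
  defines "u \<equiv> pr (drop (Suc k) As)"
  obtains p' q' where "(p' - 1) mod N = Lnew n (As ! k) a" "(q' - 1) mod N = a"
    "\<And>m p q. u p = p' + m * N \<Longrightarrow> u q = q' + m * N \<Longrightarrow>
       p mod N \<noteq> q mod N \<and> crossing As p q k \<and> u p < u q \<and> pr (rem As k a) = pr As \<circ> tr n p q"
proof -
  have A: "proper n (As ! k)" using P k by simp
  have u: "equivariant u" unfolding u_def by (rule equivariant_pr[OF propers_drop[OF P]])
  have cA: "equivariant (cdf (As ! k))" by (rule equivariant_cdf[OF A])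
  obtain p' q' where w: "p' < q'" "(p' - 1) mod N \<notin> As ! k"
    "\<And>z. p' \<le> z \<Longrightarrow> z < q' \<Longrightarrow> z mod N \<in> As ! k" and aq: "a = (q' - 1) mod N"
    and ne: "p' mod N \<noteq> q' mod N" and l: "Lnew n (As ! k) a = (p' - 1) mod N"
    using element_wire[OF A a] by metis
  have c: "cdf (As ! k) q' < cdf (As ! k) p'" using cdf_inv_iff[OF A w(1)] w by blast
  show ?thesis
  proof (rule that)
    fix m p q assume pq: "u p = p' + m * N" "u q = q' + m * N"
    have 1: "p mod N \<noteq> q mod N"
      using ne equivariant_mod_iff[OF u, of p q] unfolding pq mod_mult_self1 by simp
    have 2: "u p < u q" using pq w(1) by simp
    have 3: "crossing As p q k"
      using c k 2 pq equivariant_shift[OF cA]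
      by (simp add: crossing_def ord_def pr_drop u_def[symmetric])
    have "(u q - 1) mod N = (q' - 1 + m * N) mod N" using pq by (simp add: algebra_simps)
    then have "a = (u q - 1) mod N" unfolding aq mod_mult_self1 by simp
    then show "p mod N \<noteq> q mod N \<and> crossing As p q k \<and> u p < u q \<and> pr (rem As k a) = pr As \<circ> tr n p q"
      using 1 2 3 crossing_removal(3)[OF P 1 3 u_def[THEN meta_eq_to_obj_eq] 2] by blast
  qed (use aq l in simp_all)
qed

lemma mod_pred_shift: "(x - 1) mod N = (y - 1) mod N \<Longrightarrow> \<exists>k. x = y + k * N"
  using mod_eq_shift[of "x - 1" "y - 1"] by fastforce

lemma equivariant_surj:
  assumes "equivariant g" obtains x where "g x = y"
  using assms by (metis equivariant_def bij_pointE)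

lemma low_wires:
  assumes "(As, k, a) \<in> marked \<alpha> v" "(As, k, a) \<in> low r"
  defines "u \<equiv> pr (drop (Suc k) As)"
  obtains s where "r mod N \<noteq> s mod N" "crossing As r s k" "u r < u s" "v = pr As \<circ> tr n r s"
proof -
  have P: "propers As" "k < length As" "a \<in> As ! k" and v: "pr (rem As k a) = v"
    using assms(1) by (auto simp: marked_def)
  have u: "equivariant u" unfolding u_def by (rule equivariant_pr[OF propers_drop[OF P(1)]])
  obtain p' q' where w: "(p' - 1) mod N = Lnew n (As ! k) a"
    "\<And>m p q. u p = p' + m * N \<Longrightarrow> u q = q' + m * N \<Longrightarrow>
       p mod N \<noteq> q mod N \<and> crossing As p q k \<and> u p < u q \<and> pr (rem As k a) = pr As \<circ> tr n p q"
    using marked_wires[OF P] unfolding u_def by metis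
  have "(u r - 1) mod N = (p' - 1) mod N" using assms(2) w(1) by (simp add: low_def u_def)
  then obtain m where m: "u r = p' + m * N" using mod_pred_shift by blast
  obtain s where "u s = q' + m * N" using equivariant_surj[OF u] .
  from w(2)[OF m this] show ?thesis using that v by metis
qed

lemma high_wires:
  assumes "(As, k, a) \<in> marked \<alpha> v" "(As, k, a) \<in> high r"
  defines "u \<equiv> pr (drop (Suc k) As)"
  obtains s where "s mod N \<noteq> r mod N" "crossing As s r k" "u s < u r" "v = pr As \<circ> tr n s r"
proof -
  have P: "propers As" "k < length As" "a \<in> As ! k" and v: "pr (rem As k a) = v"
    using assms(1) by (auto simp: marked_def)
  have u: "equivariant u" unfolding u_def by (rule equivariant_pr[OF propers_drop[OF P(1)]])
  obtain p' q' where w: "(q' - 1) mod N = a"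
    "\<And>m p q. u p = p' + m * N \<Longrightarrow> u q = q' + m * N \<Longrightarrow>
       p mod N \<noteq> q mod N \<and> crossing As p q k \<and> u p < u q \<and> pr (rem As k a) = pr As \<circ> tr n p q"
    using marked_wires[OF P] unfolding u_def by metis
  have "(u r - 1) mod N = (q' - 1) mod N" using assms(2) w(1) by (simp add: high_def u_def)
  then obtain m where m: "u r = q' + m * N" using mod_pred_shift by blast
  obtain s where "u s = p' + m * N" using equivariant_surj[OF u] .
  from w(2)[OF this m] show ?thesis using that v by metis
qed

lemma crossing_marked:
  assumes P: "propers As" and pq: "p mod N \<noteq> q mod N" and c: "crossing As p q k"
    and l: "ord As p q (Suc k)" and e: "v = pr As \<circ> tr n p q" and \<alpha>: "map card As = \<alpha>"
  obtains a where "(As, k, a) \<in> marked \<alpha> v" "(As, k, a) \<in> low p" "(As, k, a) \<in> high q"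
proof -
  define u where "u = pr (drop (Suc k) As)"
  have "u p < u q" using l by (simp add: ord_def u_def)
  note r = crossing_removal[OF P pq c u_def this refl]
  have k: "k < length As" using c by (simp add: crossing_def)
  show ?thesis
    by (rule that[of "(u q - 1) mod N"])
      (use P k \<alpha> e r in \<open>simp_all add: marked_def low_def high_def u_def[symmetric]\<close>)
qed

lemma Lmap_properties:
  assumes A: "proper n A" and a: "a \<in> A"
  shows "Lnew n A a \<notin> A" "Lnew n A a \<in> {0..<N}" "proper n (Lmap n A a)" "card (Lmap n A a) = card A"
    "Lmap n A a - {Lnew n A a} = A - {a}"
proof -
  obtain p q where "(p - 1) mod N \<notin> A" "Lnew n A a = (p - 1) mod N"
    using element_wire[OF A a] by metis
  then show 1: "Lnew n A a \<notin> A" and 2: "Lnew n A a \<in> {0..<N}" using n2 by simp_all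
  have "a \<notin> Lmap n A a" "a \<in> {0..<N}" "Lmap n A a \<subseteq> {0..<N}"
    using 1 2 a A by (auto simp: Lmap_def proper_def)
  then show "proper n (Lmap n A a)" unfolding proper_def by blast
  have "card (A - {a}) = card A - 1" "card A > 0" using a proper_finite[OF A] by (auto simp: card_gt_0_iff)
  then show "card (Lmap n A a) = card A" using 1 proper_finite[OF A] by (simp add: Lmap_def)
  show "Lmap n A a - {Lnew n A a} = A - {a}" using 1 by (auto simp: Lmap_def)
qed

text \<open>After a shift both runs start above the same gap. If one ended earlier, its top letter
  would lie in the other run, hence in \<open>B\<close> or equal to the other letter, and it is not
  in \<open>B\<close>.\<close>

lemma Lnew_inj:
  assumes A: "proper n (insert a B)" "proper n (insert b B)" and ab: "a \<notin> B" "b \<notin> B"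
    and e: "Lnew n (insert a B) a = Lnew n (insert b B) b"
  shows "a = b"
proof -
  obtain p q where w: "p < q" "\<And>z. p \<le> z \<Longrightarrow> z < q \<Longrightarrow> z mod N \<in> insert a B" "a = (q - 1) mod N"
    "Lnew n (insert a B) a = (p - 1) mod N" "(p - 1) mod N \<notin> insert a B"
    using element_wire[OF A(1)] by (metis insertI1)
  obtain p' q' where w': "p' < q'" "\<And>z. p' \<le> z \<Longrightarrow> z < q' \<Longrightarrow> z mod N \<in> insert b B" "b = (q' - 1) mod N"
    "Lnew n (insert b B) b = (p' - 1) mod N"
    using element_wire[OF A(2)] by (metis insertI1)
  obtain m where m: "p = p' + m * N" using e w(4) w'(4) mod_pred_shift by metis
  have b: "b = (q' + m * N - 1) mod N"
    using mod_mult_self1[of "q' - 1" m N] unfolding w'(3) by (simp add: algebra_simps)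
  consider "q = q' + m * N" | "q < q' + m * N" | "q' + m * N < q" by linarith
  then show ?thesis
  proof cases
    case 2
    have "(q - 1 - m * N) mod N \<in> insert b B" using 2 m w(1) by (intro w'(2)) auto
    moreover have "(q - 1 - m * N) mod N = a" using mod_mult_self1[of "q - 1" "- m" N] w(3) by simp
    ultimately show ?thesis using ab by auto
  next
    case 3
    have "(q' + m * N - 1) mod N \<in> insert a B" using 3 m w'(1) by (intro w(2)) auto
    then show ?thesis using ab b by auto
  qed (use b w(3) in simp)
qed

text \<open>No inverse is constructed: with the other letters \<open>B\<close> fixed,
  \<open>Lnew\<close> is an injective self-map of the finite complement of \<open>B\<close>, hence
  onto.\<close>

lemma Lnew_surj:
  assumes A: "proper n A" and c: "c \<in> A"
  obtains a where "a \<notin> A - {c}" "proper n (insert a (A - {c}))" "Lnew n (insert a (A - {c})) a = c"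
proof -
  define B where "B = A - {c}"
  define C where "C = {0..<N} - B"
  have cB: "c \<notin> B" by (simp add: B_def)
  have AN: "A \<subseteq> {0..<N}" "A \<noteq> {0..<N}" using A by (simp_all add: proper_def psubset_eq)
  have cN: "c \<in> {0..<N}" and BN: "B \<subseteq> {0..<N}"
    using subsetD[OF AN(1) c] subset_trans[OF Diff_subset AN(1)] by (simp_all only: B_def)
  have pr: "proper n (insert a B)" if "a \<in> C" for a
  proof -
    \<comment> \<open>Both \<open>c\<close> and some \<open>y\<close> outside \<open>A\<close> are
      missing from \<open>B\<close>, so one more letter still leaves a proper set.\<close>
    obtain y where y: "y \<in> {0..<N}" "y \<notin> A" using AN by (meson subsetI subset_antisym)
    then have yB: "y \<notin> B" "y \<noteq> c" using c unfolding B_def by (simp, metis)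
    have "insert a B \<noteq> {0..<N}"
    proof
      assume e: "insert a B = {0..<N}"
      have "y = a" using y(1) yB(1) unfolding e[symmetric] by simp
      moreover have "c = a" using cN cB unfolding e[symmetric] by simp
      ultimately show False using yB(2) by simp
    qed
    moreover have "insert a B \<subseteq> {0..<N}" using that BN by (simp add: C_def)
    ultimately show ?thesis unfolding proper_def by (rule psubsetI[rotated])
  qed
  have "(\<lambda>a. Lnew n (insert a B) a) ` C = C"
  proof (rule endo_inj_surj)
    show "(\<lambda>a. Lnew n (insert a B) a) ` C \<subseteq> C"
    proof (rule image_subsetI)
      fix a assume "a \<in> C"
      from Lmap_properties(1,2)[OF pr[OF this] insertI1]
      show "Lnew n (insert a B) a \<in> C" unfolding C_def by blast
    qed
    show "inj_on (\<lambda>a. Lnew n (insert a B) a) C"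
    proof (rule inj_onI)
      fix a b assume ab: "a \<in> C" "b \<in> C" "Lnew n (insert a B) a = Lnew n (insert b B) b"
      then have "a \<notin> B" "b \<notin> B" by (simp_all add: C_def)
      then show "a = b" by (rule Lnew_inj[OF pr[OF ab(1)] pr[OF ab(2)] _ _ ab(3)])
    qed
  qed (simp add: C_def)
  moreover have "c \<in> C" using cN cB by (simp add: C_def)
  ultimately have "c \<in> (\<lambda>a. Lnew n (insert a B) a) ` C" by simp
  then obtain a where a: "a \<in> C" "Lnew n (insert a B) a = c" by (elim imageE) simp
  then have "a \<notin> B" by (simp add: C_def)
  from that[folded B_def, OF this pr[OF a(1)] a(2)] show ?thesis .
qed

text \<open>Deleting the mark before or after the move leaves the same tuple, hence the same
  \<open>v\<close>, and \<open>low r\<close> for the old letter reads as \<open>high r\<close> for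
  the new one. Injectivity and surjectivity are those of \<open>Lnew\<close> with the remaining
  letters fixed.\<close>

lemma Lshift_bij: "bij_betw Lshift (marked \<alpha> v \<inter> low r) (marked \<alpha> v \<inter> high r)"
  unfolding bij_betw_def
proof
  have into: "Lshift x \<in> marked \<alpha> v \<inter> high r" if x: "x \<in> marked \<alpha> v \<inter> low r" for x
  proof -
    obtain As k a where xe: "x = (As, k, a)" by (cases x) auto
    have P: "propers As" "map card As = \<alpha>" "k < length As" "a \<in> As ! k" "pr (rem As k a) = v"
      and l: "(pr (drop (Suc k) As) r - 1) mod N = Lnew n (As ! k) a"
      using x xe by (auto simp: marked_def low_def)
    have A: "proper n (As ! k)" using P by simp
    note LA = Lmap_properties[OF A P(4)]
    have "map card (As[k := Lmap n (As ! k) a]) = \<alpha>" using P LA(4) by (metis list_update_id map_update)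
    moreover have "propers (As[k := Lmap n (As ! k) a])" using P LA(3) by (intro propers_update)
    moreover have "rem (As[k := Lmap n (As ! k) a]) k (Lnew n (As ! k) a) = rem As k a"
      using P LA(5) by (simp add: rem_def)
    moreover have "Lnew n (As ! k) a \<in> Lmap n (As ! k) a" by (simp add: Lmap_def)
    ultimately show ?thesis using P l by (simp add: xe Lshift_def marked_def high_def)
  qed
  show "inj_on Lshift (marked \<alpha> v \<inter> low r)"
  proof (rule inj_onI)
    fix x y assume x: "x \<in> marked \<alpha> v \<inter> low r" and y: "y \<in> marked \<alpha> v \<inter> low r" and e: "Lshift x = Lshift y"
    obtain As k a where xe: "x = (As, k, a)" by (cases x) auto
    obtain Bs j b where ye: "y = (Bs, j, b)" by (cases y) auto
    have j: "j = k" using e by (simp add: xe ye Lshift_def)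
    have n: "Lnew n (As ! k) a = Lnew n (Bs ! k) b" and
      u: "As[k := Lmap n (As ! k) a] = Bs[k := Lmap n (Bs ! k) b]"
      using e by (simp_all add: xe ye Lshift_def j)
    have P: "propers As" "k < length As" "a \<in> As ! k" and Q: "propers Bs" "k < length Bs" "b \<in> Bs ! k"
      using x y by (auto simp: xe ye j marked_def)
    have A: "proper n (As ! k)" and B: "proper n (Bs ! k)" using P Q by simp_all
    have "Lmap n (As ! k) a = Lmap n (Bs ! k) b" using u P(2) Q(2) by (metis nth_list_update_eq)
    then have AB: "As ! k - {a} = Bs ! k - {b}"
      using Lmap_properties(5)[OF A P(3)] Lmap_properties(5)[OF B Q(3)] n by simp
    define C where "C = As ! k - {a}"
    have C: "As ! k = insert a C" "Bs ! k = insert b C" "a \<notin> C" "b \<notin> C"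
      using P(3) Q(3) AB by (auto simp: C_def)
    have ab: "a = b" using Lnew_inj[of a C b] A B n C by simp
    have "As = Bs"
    proof (rule nth_equalityI)
      show "length As = length Bs" using u by (metis length_list_update)
      fix i assume "i < length As"
      show "As ! i = Bs ! i"
      proof (cases "i = k")
        case True
        then show ?thesis using C(1,2) ab by simp
      next
        case False
        then show ?thesis using arg_cong[OF u, of "\<lambda>xs. xs ! i"] by simp
      qed
    qed
    then show "x = y" by (simp add: xe ye j ab)
  qed
  show "Lshift ` (marked \<alpha> v \<inter> low r) = marked \<alpha> v \<inter> high r"
  proof
    show "Lshift ` (marked \<alpha> v \<inter> low r) \<subseteq> marked \<alpha> v \<inter> high r" using into by blast
    show "marked \<alpha> v \<inter> high r \<subseteq> Lshift ` (marked \<alpha> v \<inter> low r)"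
    proof
      fix y assume y: "y \<in> marked \<alpha> v \<inter> high r"
      obtain As k c where ye: "y = (As, k, c)" by (cases y) auto
      have P: "propers As" "map card As = \<alpha>" "k < length As" "c \<in> As ! k" "pr (rem As k c) = v"
        and h: "(pr (drop (Suc k) As) r - 1) mod N = c"
        using y ye by (auto simp: marked_def high_def)
      have A: "proper n (As ! k)" using P by simp
      obtain a where a: "a \<notin> As ! k - {c}" "proper n (insert a (As ! k - {c}))"
        "Lnew n (insert a (As ! k - {c})) a = c" using Lnew_surj[OF A P(4)] .
      define B where "B = insert a (As ! k - {c})"
      have Ba: "B - {a} = As ! k - {c}" using a(1) by (auto simp: B_def)
      have "Lnew n B a = c" using a(3) by (simp add: B_def)
      then have LB: "Lmap n B a = As ! k" unfolding Lmap_def Ba using P(4) by blast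
      have cB: "card B = card (As ! k)"
        using Lmap_properties(4)[of B a] a(2) LB by (simp add: B_def)
      let ?x = "(As[k := B], k, a)"
      have "propers (As[k := B])" using P(1) a(2) unfolding B_def by (intro propers_update)
      moreover have "map card (As[k := B]) = \<alpha>" using P cB by (metis list_update_id map_update)
      moreover have "rem (As[k := B]) k a = rem As k c" using P(3) Ba by (simp add: rem_def)
      moreover have "a \<in> B" by (simp add: B_def)
      ultimately have "?x \<in> marked \<alpha> v \<inter> low r"
        using P h a(3) by (simp add: marked_def low_def B_def)
      moreover have "Lshift ?x = y" using P(3) LB a(3) by (simp add: ye Lshift_def B_def)
      ultimately show "y \<in> Lshift ` (marked \<alpha> v \<inter> low r)" by (metis imageI)
    qed
  qed
qed

lemma marked_finite: "finite (marked \<alpha> v)"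
proof (rule finite_subset)
  show "marked \<alpha> v \<subseteq> {As. set As \<subseteq> Pow {0..<N} \<and> length As = length \<alpha>} \<times> {..<length \<alpha>} \<times> {0..<N}"
  proof
    fix x assume x: "x \<in> marked \<alpha> v"
    obtain As k a where xe: "x = (As, k, a)" by (cases x) auto
    have P: "propers As" "map card As = \<alpha>" "k < length As" "a \<in> As ! k"
      using x xe by (auto simp: marked_def)
    have len: "length As = length \<alpha>" using P(2) by (metis length_map)
    have sub: "A \<subseteq> {0..<N}" if "A \<in> set As" for A
      using P(1) that by (simp add: proper_def psubset_imp_subset)
    then have "set As \<subseteq> Pow {0..<N}" by (meson PowI subsetI)
    moreover have "a \<in> {0..<N}" using sub[OF nth_mem[OF P(3)]] P(4) by (rule subsetD)
    moreover have "k < length \<alpha>" using P(3) unfolding len .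
    ultimately show "x \<in> {As. set As \<subseteq> Pow {0..<N} \<and> length As = length \<alpha>} \<times> {..<length \<alpha>} \<times> {0..<N}"
      unfolding xe using len by (intro SigmaI CollectI conjI) simp_all
  qed
  show "finite ({As. set As \<subseteq> Pow {0..<N} \<and> length As = length \<alpha>} \<times> {..<length \<alpha>} \<times> {0..<N})"
    by (intro finite_cartesian_product finite_lists_length_eq) simp_all
qed

section \<open>The second crossing of a non-reduced tuple and the switch of the mark\<close>

lemma second_crossing:
  assumes m: "(As, k, a) \<in> marked \<alpha> v" and s: "sum_list \<alpha> = len n v + 1"
    and nr: "(As, k, a) \<notin> reduced"
    and pq: "p mod N \<noteq> q mod N" and c: "crossing As p q k" and v: "v = pr As \<circ> tr n p q"
  obtains j where "j \<noteq> k" "crossing As p q j" "ord As p q (Suc j) \<noteq> ord As p q (Suc k)"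
    "\<And>i. i \<noteq> k \<Longrightarrow> crossing As p q i \<Longrightarrow> i = j"
proof -
  have P: "propers As" "map card As = \<alpha>" "k < length As" "a \<in> As ! k" "pr (rem As k a) = v"
    using m by (auto simp: marked_def)
  have e: "pr (rem As k a) = pr As \<circ> tr n p q" using P v by simp
  have w: "weight As = len n v + 1" using P s by simp
  have B: "propers (rem As k a)" by (rule propers_rem[OF P(1)])
  have isv: "is_word v" using is_word_pr[OF B] P by simp
  have prv: "pr As = v \<circ> tr n p q" using v pq by simp
  have ne: "p \<noteq> q" using pq by auto
  then have ne': "pr As p \<noteq> pr As q" using equivariant_eq_iff[OF equivariant_pr[OF P(1)]] by simp
  have vp: "v p = pr As q" "v q = pr As p" unfolding v using pq by simp_all
  \<comment> \<open>After the deletion exactly \<open>len n v\<close> letters remain, with product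
    \<open>v\<close>.\<close>
  have red: "weight (rem As k a) \<le> len n (pr (rem As k a))"
    using weight_rem[OF P(1,3,4)] w P(5) by simp
  have uniq: "i = j" if "i \<noteq> k" "crossing As p q i" "j \<noteq> k" "crossing As p q j" for i j
    using reduced_crossing_unique[OF B pq red] crossing_rem[OF P(1) pq P(3) e] that by blast
  have "\<exists>j. j \<noteq> k \<and> crossing As p q j"
  proof (rule ccontr)
    assume no: "\<not> ?thesis"
    then have nc: "\<not> crossing As p q i" if "i \<noteq> k" for i using that by blast
    have "ord As p q 0 = ord As p q k"
      by (rule ord_constant) (use P(3) nc in auto)
    moreover have "ord As p q (Suc k) = ord As p q (length As)"
      by (rule ord_constant) (use P(3) nc in \<open>auto simp: Suc_le_eq\<close>)
    \<comment> \<open>Only the marked crossing would change the order, so \<open>pr As\<close>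
      reverses the pair. Then \<open>v\<close>, which differs by the reflection, keeps its order and
      is shorter.\<close>
    ultimately have o: "(pr As p < pr As q) \<noteq> (p < q)"
      using c ord_0[of As p q] ord_length[of As p q] unfolding crossing_def by blast
    have "len n v < len n (pr As)"
    proof (cases "p < q")
      case True
      then have "v p < v q" using o ne' vp by simp
      from len_tr_greater[OF isv True pq this] show ?thesis unfolding prv .
    next
      case False
      then have "v q < v p" "q < p" using o ne vp by simp_all
      from len_tr_greater[OF isv this(2) pq[symmetric] this(1)] show ?thesis
        unfolding prv tr_commute[OF pq] .
    qed
    then have "len n (pr As) = weight As" using len_pr_le[OF P(1)] w by simp
    then show False using nr by (simp add: reduced_def)
  qed
  then obtain j where j: "j \<noteq> k" "crossing As p q j" by blast
  \<comment> \<open>Between the two crossings the order is constant, so the wires arrive at one of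
    them in the order opposite to that at the other.\<close>
  have "ord As p q (Suc x) \<noteq> ord As p q (Suc y)"
    if "x < y" "crossing As p q x" "crossing As p q y" "{x, y} = {j, k}" for x y
  proof -
    have "ord As p q (Suc x) = ord As p q y"
    proof (rule ord_constant)
      show "y \<le> length As" using that(3) by (simp add: crossing_def)
      show "\<not> crossing As p q i" if i: "Suc x \<le> i" "i < y" for i
      proof
        assume "crossing As p q i"
        moreover have "i \<noteq> j" "i \<noteq> k" using i \<open>{x, y} = {j, k}\<close> by (auto simp: doubleton_eq_iff)
        ultimately show False using uniq j by blast
      qed
    qed (use that in simp)
    then show ?thesis using that(3) by (simp add: crossing_def)
  qed
  from this[of j k] this[of k j] have "ord As p q (Suc j) \<noteq> ord As p q (Suc k)"
    using j c by (cases "j < k") auto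
  then show ?thesis using that[of j] j uniq by blast
qed

text \<open>The search condition of the loop: another factor of the same tuple contains a letter
  whose deletion gives \<open>v\<close>.\<close>

definition partner :: "nat list \<Rightarrow> (int \<Rightarrow> int) \<Rightarrow> int set list \<times> nat \<times> int \<Rightarrow> int set list \<times> nat \<times> int \<Rightarrow> bool" where
  "partner \<alpha> v x y \<longleftrightarrow> fst x = fst y \<and> fst (snd x) \<noteq> fst (snd y) \<and> x \<in> marked \<alpha> v \<and> y \<in> marked \<alpha> v"

lemma partner_sym: "partner \<alpha> v x y \<Longrightarrow> partner \<alpha> v y x"
  by (auto simp: partner_def)

text \<open>Any deletion giving \<open>v\<close> multiplies by the same reflection, so it is a
  crossing of the same pair; \<open>j\<close> is the only such factor besides \<open>k\<close>, and
  within it the letter is forced.\<close>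

lemma partner_unique:
  assumes "(As, k, a) \<in> marked \<alpha> v" "v = pr As \<circ> tr n p q" "p mod N \<noteq> q mod N"
    and j: "\<And>i. i \<noteq> k \<Longrightarrow> crossing As p q i \<Longrightarrow> i = j" and b: "(As, j, b) \<in> marked \<alpha> v"
    and y: "partner \<alpha> v (As, k, a) y"
  shows "y = (As, j, b)"
proof -
  obtain i c where ye: "y = (As, i, c)" and ik: "i \<noteq> k" and m: "(As, i, c) \<in> marked \<alpha> v"
    using y by (cases y) (auto simp: partner_def)
  have c: "propers As" "i < length As" "c \<in> As ! i" "pr (rem As i c) = pr As \<circ> tr n p q"
    using m assms(2) by (auto simp: marked_def)
  have "i = j" using j[OF ik] removal_crossing(1)[OF c(1) assms(3) c(2-4)] by blast
  moreover have "b \<in> As ! j" "pr (rem As j b) = pr As \<circ> tr n p q" using b assms(2) by (auto simp: marked_def)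
  ultimately show ?thesis using removal_unique[OF c(1) assms(3) c(2-4)] by (simp add: ye)
qed

text \<open>The pair arrives at its other crossing in the opposite order, so \<open>r\<close>, the
  upper wire at \<open>k\<close>, is the lower one there.\<close>

lemma partner_high:
  assumes s: "sum_list \<alpha> = len n v + 1" and x: "x \<in> marked \<alpha> v \<inter> high r - reduced"
  shows "\<exists>!y. partner \<alpha> v x y" "partner \<alpha> v x y \<Longrightarrow> y \<in> marked \<alpha> v \<inter> low r - reduced"
proof -
  obtain As k a where xe: "x = (As, k, a)" by (cases x) auto
  have m: "(As, k, a) \<in> marked \<alpha> v" and h: "(As, k, a) \<in> high r" and nr: "(As, k, a) \<notin> reduced"
    using x xe by auto
  have P: "propers As" "map card As = \<alpha>" using m by (auto simp: marked_def)
  obtain t where t: "t mod N \<noteq> r mod N" "crossing As t r k"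
    "pr (drop (Suc k) As) t < pr (drop (Suc k) As) r" "v = pr As \<circ> tr n t r"
    using high_wires[OF m h] .
  obtain j where j: "j \<noteq> k" "crossing As t r j" "ord As t r (Suc j) \<noteq> ord As t r (Suc k)"
    "\<And>i. i \<noteq> k \<Longrightarrow> crossing As t r i \<Longrightarrow> i = j"
    using second_crossing[OF m s nr t(1,2,4)] by metis
  have "ord As t r (Suc k)" using t(3) by (simp add: ord_def)
  then have "ord As r t (Suc j)" using j(3) ord_sym[OF P(1) t(1)] by simp
  moreover have "crossing As r t j" using crossing_sym[OF P(1) t(1)] j(2) by simp
  moreover have "v = pr As \<circ> tr n r t" using t(4) tr_commute[OF t(1)] by simp
  ultimately obtain b where b: "(As, j, b) \<in> marked \<alpha> v" "(As, j, b) \<in> low r"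
    using crossing_marked[OF P(1) t(1)[symmetric] _ _ _ P(2)] by blast
  have p: "partner \<alpha> v x (As, j, b)" using j(1) b m by (simp add: partner_def xe)
  have u: "y = (As, j, b)" if "partner \<alpha> v x y" for y
    using partner_unique[OF m t(4,1) j(4) b(1)] that xe by simp
  show "\<exists>!y. partner \<alpha> v x y" using p u by blast
  show "y \<in> marked \<alpha> v \<inter> low r - reduced" if "partner \<alpha> v x y"
    using u[OF that] b nr by (simp add: reduced_def)
qed

lemma partner_low:
  assumes s: "sum_list \<alpha> = len n v + 1" and x: "x \<in> marked \<alpha> v \<inter> low r - reduced"
  shows "\<exists>!y. partner \<alpha> v x y" "partner \<alpha> v x y \<Longrightarrow> y \<in> marked \<alpha> v \<inter> high r - reduced"
proof -
  obtain As k a where xe: "x = (As, k, a)" by (cases x) auto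
  have m: "(As, k, a) \<in> marked \<alpha> v" and h: "(As, k, a) \<in> low r" and nr: "(As, k, a) \<notin> reduced"
    using x xe by auto
  have P: "propers As" "map card As = \<alpha>" using m by (auto simp: marked_def)
  obtain t where t: "r mod N \<noteq> t mod N" "crossing As r t k"
    "pr (drop (Suc k) As) r < pr (drop (Suc k) As) t" "v = pr As \<circ> tr n r t"
    using low_wires[OF m h] .
  obtain j where j: "j \<noteq> k" "crossing As r t j" "ord As r t (Suc j) \<noteq> ord As r t (Suc k)"
    "\<And>i. i \<noteq> k \<Longrightarrow> crossing As r t i \<Longrightarrow> i = j"
    using second_crossing[OF m s nr t(1,2,4)] by metis
  have "ord As r t (Suc k)" using t(3) by (simp add: ord_def)
  then have "ord As t r (Suc j)" using j(3) ord_sym[OF P(1) t(1)] by simp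
  moreover have "crossing As t r j" using crossing_sym[OF P(1) t(1)] j(2) by simp
  moreover have "v = pr As \<circ> tr n t r" using t(4) tr_commute[OF t(1)] by simp
  ultimately obtain b where b: "(As, j, b) \<in> marked \<alpha> v" "(As, j, b) \<in> high r"
    using crossing_marked[OF P(1) t(1)[symmetric] _ _ _ P(2)] by blast
  have p: "partner \<alpha> v x (As, j, b)" using j(1) b m by (simp add: partner_def xe)
  have u: "y = (As, j, b)" if "partner \<alpha> v x y" for y
    using partner_unique[OF m t(4,1) j(4) b(1)] that xe by simp
  show "\<exists>!y. partner \<alpha> v x y" using p u by blast
  show "y \<in> marked \<alpha> v \<inter> high r - reduced" if "partner \<alpha> v x y"
    using u[OF that] b nr by (simp add: reduced_def)
qed

definition switch :: "nat list \<Rightarrow> (int \<Rightarrow> int) \<Rightarrow> int set list \<times> nat \<times> int \<Rightarrow> int set list \<times> nat \<times> int" where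
  "switch \<alpha> v x = (THE y. partner \<alpha> v x y)"

text \<open>Partnership is symmetric, so \<open>switch\<close> is its own inverse between the two
  sets.\<close>

lemma switch_bij:
  assumes s: "sum_list \<alpha> = len n v + 1"
  shows "bij_betw (switch \<alpha> v) (marked \<alpha> v \<inter> high r - reduced) (marked \<alpha> v \<inter> low r - reduced)"
proof (rule bij_betw_byWitness[where f' = "switch \<alpha> v"])
  note H = partner_high[OF s, of _ r] and L = partner_low[OF s, of _ r]
  have sw: "partner \<alpha> v x (switch \<alpha> v x)" if "\<exists>!y. partner \<alpha> v x y" for x
    unfolding switch_def using that by (rule theI')
  have sw_eq: "switch \<alpha> v x = y" if "\<exists>!y. partner \<alpha> v x y" "partner \<alpha> v x y" for x y
    unfolding switch_def using that by (rule the1_equality)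
  have H2: "switch \<alpha> v x \<in> marked \<alpha> v \<inter> low r - reduced"
    if "x \<in> marked \<alpha> v \<inter> high r - reduced" for x
    using H(2)[OF that sw[OF H(1)[OF that]]] .
  have L2: "switch \<alpha> v x \<in> marked \<alpha> v \<inter> high r - reduced"
    if "x \<in> marked \<alpha> v \<inter> low r - reduced" for x
    using L(2)[OF that sw[OF L(1)[OF that]]] .
  show "\<forall>x\<in>marked \<alpha> v \<inter> high r - reduced. switch \<alpha> v (switch \<alpha> v x) = x"
    by (intro ballI sw_eq L(1) H2 partner_sym[OF sw] H(1))
  show "\<forall>x\<in>marked \<alpha> v \<inter> low r - reduced. switch \<alpha> v (switch \<alpha> v x) = x"
    by (intro ballI sw_eq H(1) L2 partner_sym[OF sw] L(1))
  show "switch \<alpha> v ` (marked \<alpha> v \<inter> high r - reduced) \<subseteq> marked \<alpha> v \<inter> low r - reduced"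
    by (intro image_subsetI H2)
  show "switch \<alpha> v ` (marked \<alpha> v \<inter> low r - reduced) \<subseteq> marked \<alpha> v \<inter> high r - reduced"
    by (intro image_subsetI L2)
qed

section \<open>The algorithm\<close>

abbreviation perms :: "int set list \<Rightarrow> (int \<Rightarrow> int) list" where
  "perms As \<equiv> map (wA n) As"

lemma prodl_perms: "propers As \<Longrightarrow> prodl (perms As) = pr As"
  by (induction As) (simp_all add: prodl_def wA_cdf)

lemma wA_inj: "proper n A \<Longrightarrow> proper n B \<Longrightarrow> wA n A = wA n B \<Longrightarrow> A = B"
  using cdset_wA by metis

lemma perms_inj:
  assumes "propers As" "propers Bs" "perms As = perms Bs" shows "As = Bs"
proof -
  have "inj_on (wA n) (set As \<union> set Bs)"
    using assms(1,2) by (intro inj_onI wA_inj) blast+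
  then show ?thesis using assms(3) inj_on_map_eq_map by blast
qed

lemma removal_pos_perms:
  assumes "propers As"
  shows "removal_pos n v (perms As) i a \<longleftrightarrow> i < length As \<and> a \<in> As ! i \<and> v = pr (rem As i a)"
proof (cases "i < length As")
  case True
  then have A: "proper n (As ! i)" using assms by simp
  have u: "(perms As)[i := wA n (As ! i - {a})] = perms (rem As i a)"
    by (simp add: rem_def map_update)
  have c: "cdset n (perms As ! i) = As ! i" using True cdset_wA[OF A] by simp
  show ?thesis unfolding removal_pos_def c u prodl_perms[OF propers_rem[OF assms]] by simp
qed (simp add: removal_pos_def)

lemma removal_pos_marked:
  assumes "propers As" "map card As = \<alpha>"
  shows "removal_pos n v (perms As) i a \<longleftrightarrow> (As, i, a) \<in> marked \<alpha> v"
  unfolding removal_pos_perms[OF assms(1)] using assms by (auto simp: marked_def)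

lemma step_tuple_perms:
  assumes "propers As" "i < length As"
  shows "step_tuple n (perms As) i a = perms (As[i := Lmap n (As ! i) a])"
proof -
  have "proper n (As ! i)" using assms by simp
  then show ?thesis using assms(2) by (simp add: step_tuple_def map_update cdset_wA)
qed

lemma len_wA: "proper n A \<Longrightarrow> len n (wA n A) = card A"
  by (simp add: wA_cdf len_cdf)

lemma is_decomp_iff:
  "is_decomp n \<alpha> w ys \<longleftrightarrow>
     (\<exists>As. propers As \<and> map card As = \<alpha> \<and> ys = perms As \<and> w = pr As \<and> len n w = sum_list \<alpha>)"
proof
  assume d: "is_decomp n \<alpha> w ys"
  define As where "As = map (cdset n) ys"
  have y: "proper n (cdset n y) \<and> wA n (cdset n y) = y" if "y \<in> set ys" for y
  proof -
    obtain k where "k < length ys" "y = ys ! k" using \<open>y \<in> set ys\<close> by (metis in_set_conv_nth)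
    then have "cyc_dec n y" using d unfolding is_decomp_def by blast
    then obtain A where "proper n A" "y = wA n A" unfolding cyc_dec_def by blast
    then show ?thesis using cdset_wA by simp
  qed
  have P: "propers As" using y by (simp add: As_def)
  have e: "ys = perms As" using y by (simp add: As_def map_idI)
  have "map card As = \<alpha>"
  proof (rule nth_equalityI)
    show "length (map card As) = length \<alpha>" using d by (simp add: As_def is_decomp_def)
    fix k assume k: "k < length (map card As)"
    then have "len n (ys ! k) = \<alpha> ! k" using d by (simp add: As_def is_decomp_def)
    moreover have "len n (perms As ! k) = card (As ! k)" using k P len_wA by simp
    ultimately show "map card As ! k = \<alpha> ! k" using k e by simp
  qed
  moreover have "w = pr As" using d e prodl_perms[OF P] by (simp add: is_decomp_def)
  moreover have "len n w = sum_list \<alpha>" using d unfolding is_decomp_def by blast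
  ultimately show "\<exists>As. propers As \<and> map card As = \<alpha> \<and> ys = perms As \<and> w = pr As \<and> len n w = sum_list \<alpha>"
    using P e by blast
next
  assume "\<exists>As. propers As \<and> map card As = \<alpha> \<and> ys = perms As \<and> w = pr As \<and> len n w = sum_list \<alpha>"
  then obtain As where As: "propers As" "map card As = \<alpha>" "ys = perms As" "w = pr As"
    "len n w = sum_list \<alpha>" by blast
  have "cyc_dec n (ys ! k) \<and> len n (ys ! k) = \<alpha> ! k" if "k < length ys" for k
  proof -
    have k: "k < length As" using that As(3) by simp
    then have A: "proper n (As ! k)" using As(1) by simp
    have "ys ! k = wA n (As ! k)" "\<alpha> ! k = card (As ! k)" using k As(2,3) by auto
    then show ?thesis using A len_wA[OF A] unfolding cyc_dec_def by auto
  qed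
  moreover have "length ys = length \<alpha>" using As(2,3) by auto
  moreover have "w = prodl ys" unfolding As(3,4) using prodl_perms[OF As(1)] by simp
  ultimately show "is_decomp n \<alpha> w ys" using As(5) unfolding is_decomp_def by blast
qed

lemma is_decomp_reduced:
  assumes "propers As" "map card As = \<alpha>"
  shows "is_decomp n \<alpha> (prodl (perms As)) (perms As) \<longleftrightarrow> (As, k, a) \<in> reduced"
proof -
  have "is_decomp n \<alpha> (pr As) (perms As) \<longleftrightarrow> len n (pr As) = sum_list \<alpha>"
    unfolding is_decomp_iff using assms perms_inj by blast
  then show ?thesis using assms by (simp add: prodl_perms reduced_def)
qed

abbreviation underlying :: "int set list \<times> nat \<times> int \<Rightarrow> (int \<Rightarrow> int) list" where
  "underlying x \<equiv> perms (fst x)"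

text \<open>The two rules exclude each other, and the uniqueness premise of \<open>loop_on\<close>
  fixes the next mark.\<close>

lemma little_from_unique:
  "little_from n \<alpha> v ys i a zs \<Longrightarrow> little_from n \<alpha> v ys i a zs' \<Longrightarrow> zs = zs'"
proof (induction arbitrary: zs' rule: little_from.induct)
  case (stop_out ys i a)
  from stop_out(2,1) show ?case by cases auto
next
  case (loop_on ys i a j b zs)
  from loop_on(7) show ?case
  proof cases
    case (loop_on j' b')
    have "(j', b') = (j, b)"
      using loop_on(3,4) local.loop_on.hyps(2-4) by blast
    then show ?thesis using loop_on(5) local.loop_on.IH by simp
  qed (use loop_on(1) in simp)
qed

text \<open>The invariant is that each loop starts from a low mark. \<open>Lshift\<close> makes it
  high, and if the tuple is not reduced, \<open>partner_high\<close> supplies the unique next mark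
  that \<open>loop_on\<close> demands and makes it low again.\<close>

lemma little_from_alternating:
  assumes s: "sum_list \<alpha> = len n v + 1"
  shows "alternating Lshift (switch \<alpha> v) reduced x y \<Longrightarrow> x \<in> marked \<alpha> v \<inter> low r \<Longrightarrow>
    little_from n \<alpha> v (underlying x) (fst (snd x)) (snd (snd x)) (underlying y)"
proof (induction rule: alternating.induct)
  case (stop x)
  obtain As k a where x: "x = (As, k, a)" by (cases x) auto
  have P: "propers As" "k < length As" using stop(2) by (auto simp: x marked_def)
  have Lx: "Lshift x = (As[k := Lmap n (As ! k) a], k, Lnew n (As ! k) a)" by (simp add: x Lshift_def)
  have "Lshift x \<in> marked \<alpha> v" using bij_betwE[OF Lshift_bij] stop(2) by blast
  then have Q: "propers (As[k := Lmap n (As ! k) a])" "map card (As[k := Lmap n (As ! k) a]) = \<alpha>"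
    unfolding Lx by (auto simp: marked_def)
  note st = step_tuple_perms[OF P, of a]
  have "little_from n \<alpha> v (perms As) k a (step_tuple n (perms As) k a)"
    by (rule little_from.stop_out) (use stop(1) is_decomp_reduced[OF Q] Lx st in simp)
  then show ?case unfolding st Lx by (simp add: x)
next
  case (continue x y)
  obtain As k a where x: "x = (As, k, a)" by (cases x) auto
  have P: "propers As" "k < length As" using continue(4) by (auto simp: x marked_def)
  define Bs where "Bs = As[k := Lmap n (As ! k) a]"
  have Lx: "Lshift x = (Bs, k, Lnew n (As ! k) a)" by (simp add: x Lshift_def Bs_def)
  have m: "Lshift x \<in> marked \<alpha> v \<inter> high r - reduced"
    using bij_betwE[OF Lshift_bij] continue(1,4) by blast
  then have Q: "propers Bs" "map card Bs = \<alpha>" unfolding Lx by (auto simp: marked_def)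
  have st: "step_tuple n (perms As) k a = perms Bs" unfolding Bs_def by (rule step_tuple_perms[OF P])
  have ex1: "\<exists>!z. partner \<alpha> v (Lshift x) z" by (rule partner_high(1)[OF s m])
  have p: "partner \<alpha> v (Lshift x) (switch \<alpha> v (Lshift x))"
    unfolding switch_def using ex1 by (rule theI')
  obtain Cs j b where sw: "switch \<alpha> v (Lshift x) = (Cs, j, b)" by (metis prod_cases3)
  have C: "Cs = Bs" "j \<noteq> k" "(Bs, j, b) \<in> marked \<alpha> v" using p[unfolded sw, unfolded Lx] by (auto simp: partner_def)
  have in_low: "switch \<alpha> v (Lshift x) \<in> marked \<alpha> v \<inter> low r"
    using partner_high(2)[OF s m p] by blast
  have "little_from n \<alpha> v (perms As) k a (underlying y)"
  proof (rule little_from.loop_on)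
    show "\<not> is_decomp n \<alpha> (prodl (step_tuple n (perms As) k a)) (step_tuple n (perms As) k a)"
      using continue(1) is_decomp_reduced[OF Q] unfolding st Lx by blast
    show r: "removal_pos n v (step_tuple n (perms As) k a) j b"
      unfolding st removal_pos_marked[OF Q] by (rule C(3))
    show "\<exists>!(j, b). j \<noteq> k \<and> removal_pos n v (step_tuple n (perms As) k a) j b"
    proof (rule ex1I[of _ "(j, b)"])
      show "case (j, b) of (j, b) \<Rightarrow> j \<noteq> k \<and> removal_pos n v (step_tuple n (perms As) k a) j b"
        using r C(2) by simp
      fix z assume z: "case z of (j, b) \<Rightarrow> j \<noteq> k \<and> removal_pos n v (step_tuple n (perms As) k a) j b"
      obtain i c where zi: "z = (i, c)" by (cases z) auto
      have "partner \<alpha> v (Lshift x) (Bs, i, c)"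
        using z m unfolding zi st removal_pos_marked[OF Q] partner_def Lx by auto
      then have "(Bs, i, c) = (Cs, j, b)" using ex1 p sw by (metis (no_types))
      then show "z = (j, b)" by (simp add: zi)
    qed
    show "j \<noteq> k" by (rule C(2))
    show "little_from n \<alpha> v (step_tuple n (perms As) k a) j b (underlying y)"
      using continue.IH[OF in_low] unfolding sw st C(1) by simp
  qed
  then show ?case unfolding x by simp
qed

section \<open>Reduced marked tuples as decompositions of covers of \<open>v\<close>\<close>

lemma reduced_marked_unique:
  assumes "(As, k, a) \<in> marked \<alpha> v" "(As, j, b) \<in> marked \<alpha> v" "(As, k, a) \<in> reduced"
    and "p mod N \<noteq> q mod N" "v = pr As \<circ> tr n p q"
  shows "j = k \<and> b = a"
proof -
  have P: "propers As" "weight As \<le> len n (pr As)"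
    "k < length As" "a \<in> As ! k" "pr (rem As k a) = pr As \<circ> tr n p q"
    "j < length As" "b \<in> As ! j" "pr (rem As j b) = pr As \<circ> tr n p q"
    using assms by (auto simp: marked_def reduced_def)
  \<comment> \<open>Both deletions multiply by the same reflection, so both marks are crossings of
    the same pair.\<close>
  have "crossing As p q j" "crossing As p q k"
    using removal_crossing(1)[OF P(1) assms(4)] P by blast+
  then have "j = k" by (rule reduced_crossing_unique[OF P(1) assms(4) P(2)])
  then show ?thesis using removal_unique[OF P(1) assms(4)] P by blast
qed

text \<open>Since \<open>w\<close> is longer than \<open>v\<close>, it reverses the pair, which
  therefore crosses, and only once as the tuple is reduced. Up to that crossing the entry order
  \<open>p < q\<close> persists, so \<open>p\<close> is the lower wire. The case
  \<open>p = r\<close> serves \<open>Psi_plus\<close>, the case \<open>q = r\<close> serves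
  \<open>Psi_minus\<close>.\<close>

lemma decomp_marked:
  assumes pq: "p < q" "p mod N \<noteq> q mod N" and w: "w = v \<circ> tr n p q" "len n w = len n v + 1"
    and d: "is_decomp n \<alpha> w ys"
  obtains As k a where "(As, k, a) \<in> marked \<alpha> v \<inter> low p \<inter> high q \<inter> reduced" "ys = perms As" "pr As = w"
proof -
  obtain As where As: "propers As" "map card As = \<alpha>" "ys = perms As" "w = pr As" "len n w = sum_list \<alpha>"
    using d unfolding is_decomp_iff by blast
  have v: "v = pr As \<circ> tr n p q" using w(1) pq(2) unfolding As(4)[symmetric] by simp
  have "is_word w" using is_word_pr[OF As(1)] As(4) by simp
  have "\<not> w p < w q"
  proof
    assume "w p < w q"
    from len_tr_greater[OF \<open>is_word w\<close> pq this] have "len n w < len n v" using v As(4) by simp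
    then show False using w(2) by simp
  qed
  then have o: "\<not> ord As p q 0" "ord As p q (length As)"
    using pq by (simp_all add: ord_0 ord_length As(4))
  then obtain k where k: "crossing As p q k" using ord_constant[of 0 "length As" As p q] by auto
  have red: "weight As \<le> len n (pr As)" using As(2,4,5) by simp
  have "ord As p q (Suc k) = ord As p q (length As)"
  proof (rule ord_constant)
    show "Suc k \<le> length As" using k by (simp add: crossing_def)
    show "\<not> crossing As p q i" if "Suc k \<le> i" for i
      using reduced_crossing_unique[OF As(1) pq(2) red k, of i] that by auto
  qed simp
  then obtain a where "(As, k, a) \<in> marked \<alpha> v" "(As, k, a) \<in> low p" "(As, k, a) \<in> high q"
    using crossing_marked[OF As(1) pq(2) k _ v As(2)] o(2) by metis
  moreover have "(As, k, a) \<in> reduced" using As(2,4,5) by (simp add: reduced_def)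
  ultimately show ?thesis using that As(3,4) by blast
qed

text \<open>The marked crossing is the only one of its pair, so the order in which the wires reach
  it is their order at entry. This turns low or high into the inequality in \<open>Psi_plus\<close>
  or \<open>Psi_minus\<close>.\<close>

lemma reduced_marked_covers:
  assumes m: "(As, k, a) \<in> marked \<alpha> v" "(As, k, a) \<in> reduced" and s: "sum_list \<alpha> = len n v + 1"
    and pq: "p mod N \<noteq> q mod N" and c: "crossing As p q k"
    and l: "pr (drop (Suc k) As) p < pr (drop (Suc k) As) q" and v: "v = pr As \<circ> tr n p q"
  shows "p < q" "pr As = v \<circ> tr n p q" "covers n v (pr As)" "is_decomp n \<alpha> (pr As) (perms As)"
proof -
  have P: "propers As" "map card As = \<alpha>" "len n (pr As) = weight As"
    using m by (auto simp: marked_def reduced_def)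
  have "ord As p q (Suc k) = ord As p q (length As)"
  proof (rule ord_constant)
    show "Suc k \<le> length As" using c by (simp add: crossing_def)
    show "\<not> crossing As p q i" if "Suc k \<le> i" for i
      using reduced_crossing_unique[OF P(1) pq _ c, of i] that P(3) by auto
  qed simp
  then show "p < q" using l ord_length[of As p q] by (simp add: ord_def)
  show e: "pr As = v \<circ> tr n p q" unfolding v using pq by simp
  have "len n (pr As) = len n v + 1" using P s by simp
  then show "covers n v (pr As)" unfolding covers_def using e pq by blast
  show "is_decomp n \<alpha> (pr As) (perms As)" unfolding is_decomp_iff using P by auto
qed

text \<open>On reduced tuples the mark can be recovered from the tuple and \<open>v\<close>, so
  forgetting it loses nothing.\<close>

lemma underlying_inj:
  assumes S: "\<And>As k a. (As, k, a) \<in> S \<Longrightarrow> (As, k, a) \<in> marked \<alpha> v \<inter> reduced \<and>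
    (\<exists>p q. p mod N \<noteq> q mod N \<and> v = pr As \<circ> tr n p q)"
  shows "inj_on underlying S"
proof (rule inj_onI)
  fix x y assume xy: "x \<in> S" "y \<in> S" "underlying x = underlying y"
  obtain As k a where x: "x = (As, k, a)" by (cases x) auto
  obtain Bs j b where y: "y = (Bs, j, b)" by (cases y) auto
  have m: "(As, k, a) \<in> marked \<alpha> v" "(As, k, a) \<in> reduced" "(Bs, j, b) \<in> marked \<alpha> v"
    using S xy x y by blast+
  have "propers As" "propers Bs" using m by (auto simp: marked_def)
  then have "Bs = As" using perms_inj[of As Bs] xy(3) by (simp add: x y)
  moreover obtain p q where "p mod N \<noteq> q mod N" "v = pr As \<circ> tr n p q" using S xy x by blast
  ultimately show "x = y" using reduced_marked_unique[of As k a \<alpha> v j b p q] m by (simp add: x y)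
qed

lemma underlying_plus:
  assumes s: "sum_list \<alpha> = len n v + 1"
  shows "bij_betw underlying (marked \<alpha> v \<inter> low r \<inter> reduced)
    {ys. \<exists>w\<in>Psi_plus n r v. is_decomp n \<alpha> w ys}"
  unfolding bij_betw_def
proof
  show "inj_on underlying (marked \<alpha> v \<inter> low r \<inter> reduced)"
  proof (rule underlying_inj)
    fix As k a assume x: "(As, k, a) \<in> marked \<alpha> v \<inter> low r \<inter> reduced"
    then obtain t where "r mod N \<noteq> t mod N" "v = pr As \<circ> tr n r t"
      using low_wires[of As k a \<alpha> v r] by blast
    then show "(As, k, a) \<in> marked \<alpha> v \<inter> reduced \<and>
      (\<exists>p q. p mod N \<noteq> q mod N \<and> v = pr As \<circ> tr n p q)" using x by blast
  qed
  show "underlying ` (marked \<alpha> v \<inter> low r \<inter> reduced) = {ys. \<exists>w\<in>Psi_plus n r v. is_decomp n \<alpha> w ys}"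
  proof (intro equalityI subsetI)
    fix ys assume "ys \<in> underlying ` (marked \<alpha> v \<inter> low r \<inter> reduced)"
    then obtain x where x: "x \<in> marked \<alpha> v \<inter> low r \<inter> reduced" "ys = underlying x" by blast
    obtain As k a where xe: "x = (As, k, a)" by (cases x) auto
    have m: "(As, k, a) \<in> marked \<alpha> v" "(As, k, a) \<in> low r" "(As, k, a) \<in> reduced"
      using x xe by auto
    obtain t where t: "r mod N \<noteq> t mod N" "crossing As r t k"
      "pr (drop (Suc k) As) r < pr (drop (Suc k) As) t" "v = pr As \<circ> tr n r t"
      using low_wires[OF m(1,2)] .
    note c = reduced_marked_covers[OF m(1,3) s t]
    have "pr As \<in> Psi_plus n r v" unfolding Psi_plus_def using c(1-3) t(1) by auto
    then show "ys \<in> {ys. \<exists>w\<in>Psi_plus n r v. is_decomp n \<alpha> w ys}" using c(4) x(2) xe by auto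
  next
    fix ys assume "ys \<in> {ys. \<exists>w\<in>Psi_plus n r v. is_decomp n \<alpha> w ys}"
    then obtain w t where w: "len n w = len n v + 1" "r < t" "t mod N \<noteq> r mod N"
      "w = v \<circ> tr n r t" "is_decomp n \<alpha> w ys"
      unfolding Psi_plus_def covers_def by blast
    obtain As k a where x: "(As, k, a) \<in> marked \<alpha> v \<inter> low r \<inter> high t \<inter> reduced" "ys = perms As"
      by (rule decomp_marked[OF w(2) w(3)[symmetric] w(4,1,5)])
    show "ys \<in> underlying ` (marked \<alpha> v \<inter> low r \<inter> reduced)"
      by (rule image_eqI[where x = "(As, k, a)"]) (use x in simp_all)
  qed
qed

lemma underlying_minus:
  assumes s: "sum_list \<alpha> = len n v + 1"
  shows "bij_betw underlying (marked \<alpha> v \<inter> high r \<inter> reduced)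
    {ys. \<exists>w\<in>Psi_minus n r v. is_decomp n \<alpha> w ys}"
  unfolding bij_betw_def
proof
  show "inj_on underlying (marked \<alpha> v \<inter> high r \<inter> reduced)"
  proof (rule underlying_inj)
    fix As k a assume x: "(As, k, a) \<in> marked \<alpha> v \<inter> high r \<inter> reduced"
    then obtain t where "t mod N \<noteq> r mod N" "v = pr As \<circ> tr n t r"
      using high_wires[of As k a \<alpha> v r] by blast
    then show "(As, k, a) \<in> marked \<alpha> v \<inter> reduced \<and>
      (\<exists>p q. p mod N \<noteq> q mod N \<and> v = pr As \<circ> tr n p q)" using x by blast
  qed
  show "underlying ` (marked \<alpha> v \<inter> high r \<inter> reduced) = {ys. \<exists>w\<in>Psi_minus n r v. is_decomp n \<alpha> w ys}"
  proof (intro equalityI subsetI)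
    fix ys assume "ys \<in> underlying ` (marked \<alpha> v \<inter> high r \<inter> reduced)"
    then obtain x where x: "x \<in> marked \<alpha> v \<inter> high r \<inter> reduced" "ys = underlying x" by blast
    obtain As k a where xe: "x = (As, k, a)" by (cases x) auto
    have m: "(As, k, a) \<in> marked \<alpha> v" "(As, k, a) \<in> high r" "(As, k, a) \<in> reduced"
      using x xe by auto
    obtain t where t: "t mod N \<noteq> r mod N" "crossing As t r k"
      "pr (drop (Suc k) As) t < pr (drop (Suc k) As) r" "v = pr As \<circ> tr n t r"
      using high_wires[OF m(1,2)] .
    note c = reduced_marked_covers[OF m(1,3) s t]
    have "pr As \<in> Psi_minus n r v" unfolding Psi_minus_def using c(1-3) t(1) by auto
    then show "ys \<in> {ys. \<exists>w\<in>Psi_minus n r v. is_decomp n \<alpha> w ys}" using c(4) x(2) xe by auto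
  next
    fix ys assume "ys \<in> {ys. \<exists>w\<in>Psi_minus n r v. is_decomp n \<alpha> w ys}"
    then obtain w t where w: "len n w = len n v + 1" "t < r" "t mod N \<noteq> r mod N"
      "w = v \<circ> tr n t r" "is_decomp n \<alpha> w ys"
      unfolding Psi_minus_def covers_def by blast
    obtain As k a where x: "(As, k, a) \<in> marked \<alpha> v \<inter> low t \<inter> high r \<inter> reduced" "ys = perms As"
      by (rule decomp_marked[OF w(2,3,4,1,5)])
    show "ys \<in> underlying ` (marked \<alpha> v \<inter> high r \<inter> reduced)"
      by (rule image_eqI[where x = "(As, k, a)"]) (use x in simp_all)
  qed
qed

text \<open>A reduced tuple has a single letter whose deletion gives \<open>v\<close>; this fixes
  the initial mark, and the run is then the alternating orbit.\<close>

lemma little_alg_alternating: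
  assumes s: "sum_list \<alpha> = len n v + 1" and x: "x \<in> marked \<alpha> v \<inter> low r \<inter> reduced"
    and y: "alternating Lshift (switch \<alpha> v) reduced x y"
  shows "little_alg n \<alpha> v (underlying x) zs \<longleftrightarrow> zs = underlying y"
proof -
  obtain As k a where xe: "x = (As, k, a)" by (cases x) auto
  have m: "(As, k, a) \<in> marked \<alpha> v" "(As, k, a) \<in> low r" "(As, k, a) \<in> reduced" using x xe by auto
  have P: "propers As" "map card As = \<alpha>" using m by (auto simp: marked_def)
  obtain t where t: "r mod N \<noteq> t mod N" "v = pr As \<circ> tr n r t" using low_wires[OF m(1,2)] by blast
  have r: "removal_pos n v (perms As) j b \<longleftrightarrow> j = k \<and> b = a" for j b
    unfolding removal_pos_marked[OF P] using reduced_marked_unique[OF m(1) _ m(3) t] m(1) by blast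
  have "x \<in> marked \<alpha> v \<inter> low r" using x by simp
  from little_from_alternating[OF s y this]
  have f: "little_from n \<alpha> v (perms As) k a (underlying y)" unfolding xe by simp
  have "\<exists>!(j, b). removal_pos n v (perms As) j b"
    by (rule ex1I[of _ "(k, a)"]) (auto simp: r)
  moreover have "(\<exists>j b. removal_pos n v (perms As) j b \<and> little_from n \<alpha> v (perms As) j b zs)
      \<longleftrightarrow> little_from n \<alpha> v (perms As) k a zs"
    by (simp add: r)
  ultimately have "little_alg n \<alpha> v (perms As) zs \<longleftrightarrow> little_from n \<alpha> v (perms As) k a zs"
    unfolding little_alg_def by simp
  also have "\<dots> \<longleftrightarrow> zs = underlying y" using f little_from_unique[OF f] by metis
  finally show ?thesis unfolding xe by simp
qed

text \<open>The algorithm is the alternating bijection transported along the two bijections that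
  forget the mark.\<close>

lemma little_bijection:
  assumes s: "sum_list \<alpha> = len n v + 1"
  shows "(\<forall>ys\<in>{ys. \<exists>w\<in>Psi_plus n r v. is_decomp n \<alpha> w ys}. \<exists>!zs. little_alg n \<alpha> v ys zs)
    \<and> bij_betw (\<lambda>ys. THE zs. little_alg n \<alpha> v ys zs)
        {ys. \<exists>w\<in>Psi_plus n r v. is_decomp n \<alpha> w ys}
        {zs. \<exists>w\<in>Psi_minus n r v. is_decomp n \<alpha> w zs}"
proof -
  let ?X = "marked \<alpha> v \<inter> low r" and ?Y = "marked \<alpha> v \<inter> high r"
  let ?alt = "alternating Lshift (switch \<alpha> v) reduced"
  let ?D = "{ys. \<exists>w\<in>Psi_plus n r v. is_decomp n \<alpha> w ys}"
  let ?E = "{ys. \<exists>w\<in>Psi_minus n r v. is_decomp n \<alpha> w ys}"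
  let ?f = "\<lambda>ys. THE zs. little_alg n \<alpha> v ys zs" and ?g = "\<lambda>x. THE y. ?alt x y"
  have fin: "finite ?X" by (rule finite_Int) (simp add: marked_finite)
  note bijs = fin Lshift_bij[of \<alpha> v r] switch_bij[OF s, of r]
  note U = underlying_plus[OF s, of r]
  have g: "?alt x (?g x)" if x: "x \<in> ?X \<inter> reduced" for x
  proof -
    obtain y where y: "?alt x y" using alternating_exists[OF bijs x] by blast
    have "?g x = y" by (rule the_equality[where P = "?alt x", OF y]) (rule alternating_unique[OF _ y])
    then show ?thesis using y by (simp only:)
  qed
  note alg = little_alg_alternating[OF s _ g]
  have 1: "\<exists>!zs. little_alg n \<alpha> v ys zs" if "ys \<in> ?D" for ys
  proof -
    have "ys \<in> underlying ` (?X \<inter> reduced)" unfolding bij_betw_imp_surj_on[OF U] by (rule that)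
    then obtain x where x: "ys = underlying x" "x \<in> ?X \<inter> reduced" by (rule imageE)
    show ?thesis unfolding x(1) alg[OF x(2) x(2)] by (rule ex1I) (rule refl)
  qed
  have 2: "?f (underlying x) = underlying (?g x)" if x: "x \<in> ?X \<inter> reduced" for x
    unfolding alg[OF x x] by (rule the_eq_trivial)
  have "bij_betw (underlying \<circ> ?g) (?X \<inter> reduced) ?E"
    by (rule bij_betw_trans[OF alternating_bij_betw[OF bijs] underlying_minus[OF s]])
  then have "bij_betw (?f \<circ> underlying) (?X \<inter> reduced) ?E"
    by (rule iffD1[OF bij_betw_cong, rotated]) (simp only: comp_apply 2)
  then have "bij_betw ?f ?D ?E" by (rule iffD2[OF bij_betw_comp_iff[OF U]])
  with 1 show ?thesis by (intro conjI ballI)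
qed

end

theorem theorem14:
  fixes n :: nat and v :: "int \<Rightarrow> int" and r :: int and \<alpha> :: "nat list"
  assumes "n \<ge> 2" and "affperm n v"
    and "\<forall>a\<in>set \<alpha>. a > 0" and "sum_list \<alpha> = len n v + 1"
  shows "(\<forall>ys\<in>{ys. \<exists>w\<in>Psi_plus n r v. is_decomp n \<alpha> w ys}. \<exists>!zs. little_alg n \<alpha> v ys zs)
    \<and> bij_betw (\<lambda>ys. THE zs. little_alg n \<alpha> v ys zs)
        {ys. \<exists>w\<in>Psi_plus n r v. is_decomp n \<alpha> w ys}
        {zs. \<exists>w\<in>Psi_minus n r v. is_decomp n \<alpha> w zs}"
proof -
  interpret affine n by standard (rule assms(1))
  show ?thesis by (rule little_bijection[OF assms(4)])
qed

end
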